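(* There exist a finite two-player zero-sum simultaneous-move game $G$ with perfect information and a $0$-Hannan consistent bandit algorithm $A$ with guaranteed exploration such that, when $A$ is used as the selection function in SM-MCTS (rather than SM-MCTS-A) on $G$, almost surely the average (equivalently, empirical-frequency) strategy profile $\hat\sigma(t)$ does not converge to the set of $\frac14$-Nash equilibria of $G$.
   Context: Game: finite rooted tree; each non-terminal node $h$ has finite action sets $\mathcal A_1(h),\mathcal A_2(h)$, each joint action $(i,j)$ leading to a child; terminal utilities $u_1\in[0,1]$, $u_2=-u_1$. $\epsilon$-Nash equilibrium: profile $\sigma$ of behavioral strategies with $\max_{\sigma'_1}u(\sigma'_1,\sigma_2)-u(\sigma)\le\epsilon$ and $u(\sigma)-\min_{\sigma'_2}u(\sigma_1,\sigma'_2)\le\epsilon$. Bandit: adaptive adversary sets rewards $x_k(t)\in[0,1]$; algorithm chooses arm $k(t)$, sees only $x_{k(t)}(t)$; $r(t)=\frac1t(\max_k\sum_{s\le t}x_k(s)-\sum_{s\le t}x_{k(s)}(s))$. $\epsilon$-Hannan consistent: $\limsup_t r(t)\le\epsilon$ a.s. against every adversary; $0$-Hannan consistent = Hannan consistent. Guaranteed exploration: when both players use the algorithm at a node, each joint action is chosen infinitely often a.s. SM-MCTS: tree $T$ (initially empty); each node in $T$ holds one instance of the algorithm per player. Iteration on the root: terminal $h$ returns $u_1(h)$; if $h\in T$ the instances choose $(i,j)$, the procedure is called on $h_{ij}$ returning $x$, player 1's instance at $h$ receives reward $x$ and player 2's the reward $1-x$, and $x$ is returned; if $h\notin T$, $h$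 is added and a rollout value returned. Empirical frequency at $h$ after $t$ visits: $\hat\sigma^h_1(t)(i)=t_i/t$ ($t_i$ = number of visits where player 1 chose $i$), similarly for player 2; $\hat\sigma(t)$ collects these over all nodes. *)

theory Defs
  imports "HOL-Probability.Probability"
begin

text \<open>A finite two-player zero-sum simultaneous-move game with perfect information, as a
rooted tree.  At a node Node m n c player 1 has the actions 0..m-1, player 2 the actions
0..n-1, and the joint action (i,j) leads to the child c i j.  Terminal nodes carry the
utility of player 1 (player 2 gets the negation).  Every value of this datatype has finite
paths, and since it is finitely branching (on the relevant actions) it is a finite tree.\<close>

datatype game = Terminal real | Node nat nat "nat \<Rightarrow> nat \<Rightarrow> game"

type_synonym path = "(nat \<times> nat) list"

primrec wf_game :: "game \<Rightarrow> bool" where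
  "wf_game (Terminal u) = (0 \<le> u \<and> u \<le> 1)"
| "wf_game (Node m n c) = (0 < m \<and> 0 < n \<and> (\<forall>i<m. \<forall>j<n. wf_game (c i j)))"

fun subgame :: "game \<Rightarrow> path \<Rightarrow> game option" where
  "subgame g [] = Some g"
| "subgame (Terminal u) (_ # _) = None"
| "subgame (Node m n c) ((i, j) # p) =
     (if i < m \<and> j < n then subgame (c i j) p else None)"

definition nodes :: "game \<Rightarrow> path set" where
  "nodes G = {p. \<exists>m n c. subgame G p = Some (Node m n c)}"

definition acts1 :: "game \<Rightarrow> path \<Rightarrow> nat" where
  "acts1 G p = (case subgame G p of Some (Node m n c) \<Rightarrow> m | _ \<Rightarrow> 0)"

definition acts2 :: "game \<Rightarrow> path \<Rightarrow> nat" where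
  "acts2 G p = (case subgame G p of Some (Node m n c) \<Rightarrow> n | _ \<Rightarrow> 0)"

type_synonym strat = "path \<Rightarrow> nat \<Rightarrow> real"

definition strategy1 :: "game \<Rightarrow> strat \<Rightarrow> bool" where
  "strategy1 G s \<longleftrightarrow> (\<forall>p\<in>nodes G. (\<forall>i<acts1 G p. 0 \<le> s p i) \<and> (\<Sum>i<acts1 G p. s p i) = 1)"

definition strategy2 :: "game \<Rightarrow> strat \<Rightarrow> bool" where
  "strategy2 G s \<longleftrightarrow> (\<forall>p\<in>nodes G. (\<forall>j<acts2 G p. 0 \<le> s p j) \<and> (\<Sum>j<acts2 G p. s p j) = 1)"

primrec util_at :: "game \<Rightarrow> path \<Rightarrow> strat \<Rightarrow> strat \<Rightarrow> real" where
  "util_at (Terminal u) p s1 s2 = u"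
| "util_at (Node m n c) p s1 s2 =
     (\<Sum>i<m. \<Sum>j<n. s1 p i * s2 p j * util_at (c i j) (p @ [(i, j)]) s1 s2)"

definition util :: "game \<Rightarrow> strat \<Rightarrow> strat \<Rightarrow> real" where
  "util G s1 s2 = util_at G [] s1 s2"

definition eps_NE :: "game \<Rightarrow> real \<Rightarrow> strat \<times> strat \<Rightarrow> bool" where
  "eps_NE G eps \<sigma> \<longleftrightarrow>
     strategy1 G (fst \<sigma>) \<and> strategy2 G (snd \<sigma>) \<and>
     (SUP s1' \<in> {s. strategy1 G s}. util G s1' (snd \<sigma>)) - util G (fst \<sigma>) (snd \<sigma>) \<le> eps \<and>
     util G (fst \<sigma>) (snd \<sigma>) - (INF s2' \<in> {s. strategy2 G s}. util G (fst \<sigma>) s2') \<le> eps"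

text \<open>Distance between profiles (L1 distance over all nodes and actions; the space of
profiles is finite-dimensional, so any norm gives the same notion of convergence).\<close>
definition prof_dist :: "game \<Rightarrow> strat \<times> strat \<Rightarrow> strat \<times> strat \<Rightarrow> real" where
  "prof_dist G \<sigma> \<tau> =
     (\<Sum>p\<in>nodes G. (\<Sum>i<acts1 G p. \<bar>fst \<sigma> p i - fst \<tau> p i\<bar>)
                  + (\<Sum>j<acts2 G p. \<bar>snd \<sigma> p j - snd \<tau> p j\<bar>))"

definition converges_to_set :: "game \<Rightarrow> (nat \<Rightarrow> strat \<times> strat) \<Rightarrow> (strat \<times> strat) set \<Rightarrow> bool" where
  "converges_to_set G f S \<longleftrightarrow>
     (\<forall>e>0. eventually (\<lambda>t. \<exists>\<tau>\<in>S. prof_dist G (f t) \<tau> < e) sequentially)"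

text \<open>A randomized bandit algorithm: given the number K of arms, its own observation history
(list of (chosen arm, observed reward)) and a fresh uniform random number from [0,1], it
deterministically selects an arm.\<close>
type_synonym bandit_alg = "nat \<Rightarrow> (nat \<times> real) list \<Rightarrow> real \<Rightarrow> nat"

definition valid_alg :: "bandit_alg \<Rightarrow> bool" where
  "valid_alg A \<longleftrightarrow>
     (\<forall>K h u. 0 < K \<longrightarrow> A K h u < K) \<and>
     (\<forall>K h. A K h \<in> borel_measurable borel)"

definition unif :: "real measure" where
  "unif = uniform_measure lborel {0..1}"

definition bandit_space :: "(nat \<Rightarrow> real) measure" where
  "bandit_space = PiM UNIV (\<lambda>_. unif)"

text \<open>An adaptive adversary: reward vector at time t as a function of the arms chosen before t.\<close>
type_synonym adversary = "nat list \<Rightarrow> nat \<Rightarrow> real"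

definition valid_adv :: "adversary \<Rightarrow> bool" where
  "valid_adv adv \<longleftrightarrow> (\<forall>h k. 0 \<le> adv h k \<and> adv h k \<le> 1)"

primrec bandit_hist :: "bandit_alg \<Rightarrow> nat \<Rightarrow> adversary \<Rightarrow> (nat \<Rightarrow> real) \<Rightarrow> nat \<Rightarrow> (nat \<times> real) list" where
  "bandit_hist A K adv \<omega> 0 = []"
| "bandit_hist A K adv \<omega> (Suc t) =
     (let h = bandit_hist A K adv \<omega> t; a = A K h (\<omega> t) in h @ [(a, adv (map fst h) a)])"

definition arm_at :: "bandit_alg \<Rightarrow> nat \<Rightarrow> adversary \<Rightarrow> (nat \<Rightarrow> real) \<Rightarrow> nat \<Rightarrow> nat" where
  "arm_at A K adv \<omega> s = fst (last (bandit_hist A K adv \<omega> (Suc s)))"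

definition reward_at :: "bandit_alg \<Rightarrow> nat \<Rightarrow> adversary \<Rightarrow> (nat \<Rightarrow> real) \<Rightarrow> nat \<Rightarrow> nat \<Rightarrow> real" where
  "reward_at A K adv \<omega> s k = adv (map fst (bandit_hist A K adv \<omega> s)) k"

definition regret :: "bandit_alg \<Rightarrow> nat \<Rightarrow> adversary \<Rightarrow> (nat \<Rightarrow> real) \<Rightarrow> nat \<Rightarrow> real" where
  "regret A K adv \<omega> t =
     (Max ((\<lambda>k. \<Sum>s<t. reward_at A K adv \<omega> s k) ` {..<K})
      - (\<Sum>s<t. reward_at A K adv \<omega> s (arm_at A K adv \<omega> s))) / real t"

definition hannan_consistent :: "real \<Rightarrow> bandit_alg \<Rightarrow> bool" where
  "hannan_consistent eps A \<longleftrightarrow>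
     (\<forall>K adv. 0 < K \<longrightarrow> valid_adv adv \<longrightarrow>
        (AE \<omega> in bandit_space. limsup (\<lambda>t. ereal (regret A K adv \<omega> t)) \<le> ereal eps))"

text \<open>Search state: for each history, None if it is not in the tree T, otherwise the list of
all visits made at it so far as triples (action of player 1, action of player 2, value x).
The random source assigns an independent uniform number to each triple
(visit index at the node, node, player) with True = player 1.\<close>
type_synonym mcts_state = "path \<Rightarrow> (nat \<times> nat \<times> real) list option"
type_synonym rand = "nat \<times> path \<times> bool \<Rightarrow> real"

primrec mcts_iter :: "bandit_alg \<Rightarrow> (path \<Rightarrow> real) \<Rightarrow> rand \<Rightarrow> game \<Rightarrow> path \<Rightarrow> mcts_state \<Rightarrow> real \<times> mcts_state" where
  "mcts_iter A roll \<omega> (Terminal u) p H = (u, H)"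
| "mcts_iter A roll \<omega> (Node m n c) p H =
     (case H p of
        None \<Rightarrow> (roll p, H(p := Some []))
      | Some hs \<Rightarrow>
          (let k = length hs;
               i = A m (map (\<lambda>(i, j, x). (i, x)) hs) (\<omega> (k, p, True));
               j = A n (map (\<lambda>(i, j, x). (j, 1 - x)) hs) (\<omega> (k, p, False));
               r = mcts_iter A roll \<omega> (c i j) (p @ [(i, j)]) H
           in (fst r, (snd r)(p := Some (hs @ [(i, j, fst r)])))))"

definition mcts_state :: "bandit_alg \<Rightarrow> (path \<Rightarrow> real) \<Rightarrow> game \<Rightarrow> rand \<Rightarrow> nat \<Rightarrow> mcts_state" where
  "mcts_state A roll G \<omega> t = ((\<lambda>H. snd (mcts_iter A roll \<omega> G [] H)) ^^ t) (\<lambda>_. None)"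

definition visits :: "bandit_alg \<Rightarrow> (path \<Rightarrow> real) \<Rightarrow> game \<Rightarrow> rand \<Rightarrow> nat \<Rightarrow> path \<Rightarrow> (nat \<times> nat \<times> real) list" where
  "visits A roll G \<omega> t p = (case mcts_state A roll G \<omega> t p of None \<Rightarrow> [] | Some hs \<Rightarrow> hs)"

definition mcts_space :: "rand measure" where
  "mcts_space = PiM UNIV (\<lambda>_. unif)"

definition valid_roll :: "(path \<Rightarrow> real) \<Rightarrow> bool" where
  "valid_roll roll \<longleftrightarrow> (\<forall>p. 0 \<le> roll p \<and> roll p \<le> 1)"

definition emp_profile :: "bandit_alg \<Rightarrow> (path \<Rightarrow> real) \<Rightarrow> game \<Rightarrow> rand \<Rightarrow> nat \<Rightarrow> strat \<times> strat" where
  "emp_profile A roll G \<omega> t =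
     ((\<lambda>p i. let hs = visits A roll G \<omega> t p in
              if hs = [] then 1 / real (acts1 G p)
              else real (length (filter (\<lambda>(a, b, x). a = i) hs)) / real (length hs)),
      (\<lambda>p j. let hs = visits A roll G \<omega> t p in
              if hs = [] then 1 / real (acts2 G p)
              else real (length (filter (\<lambda>(a, b, x). b = j) hs)) / real (length hs)))"

definition guaranteed_exploration :: "bandit_alg \<Rightarrow> bool" where
  "guaranteed_exploration A \<longleftrightarrow>
     (\<forall>G roll. wf_game G \<longrightarrow> valid_roll roll \<longrightarrow>
       (AE \<omega> in mcts_space. \<forall>p\<in>nodes G.
          (\<forall>N. \<exists>t. N \<le> length (visits A roll G \<omega> t p)) \<longrightarrow>
          (\<forall>i<acts1 G p. \<forall>j<acts2 G p. \<forall>N. \<exists>t.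
             N \<le> length (filter (\<lambda>(a, b, x). a = i \<and> b = j) (visits A roll G \<omega> t p)))))"

end

theory Submission
  imports Defs
begin

text \<open>
In the inner game (matching pennies) both players can follow a fixed pattern with period four that
produces the values 1, 0, 1, 0, ... and leaves neither of them any regret.  At the root, player 1
enters the inner game twice in a row, once for the value 1 and once for the value 0, and then waits.
While he waits, the next value of the inner game is 0, so entering it does not look attractive, and
he has no regret either, although he enters with frequency 1/8 only and the inner game is worth 1/2.

The algorithm plays this pattern as long as the estimated regrets of the current block of time are
below a threshold that is sublinear in the length of the block, and otherwise plays regret matching
on the excess.  The estimated regrets are unbiased, and a quadratic potential shows that the regret
of each block is sublinear against every adversary.  The estimates use the rewards that the pattern
predicts as a control variate.  In self-play they are therefore wrong only at coincidences of
exploration steps, which are so rare that almost surely all but finitely many blocks follow the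
pattern entirely.
\<close>

text \<open>The obstacle: regret must vanish against every adversary, yet self-play has to keep to
  the pattern although both players never stop exploring. Waiting is compatible with vanishing
  regret because regret compares with the rewards of the realised history. The inner game advances
  only when it is entered, so at every waiting step the same next value 0 is all that player 1
  forgoes. The powers of the block number n form a budget. Blocks start at n^20 and have length of
  order n^19. Two players explore together with probability at least of order n^-20, about 1/t,
  which is just not summable. Within a block the potential grows to at most order n^(10+19), below
  the square n^36 of the threshold n^18. By the end of block n each inner player has deviated about
  n^10 times, with weight n^4 at the root, and the root player about n^16 times; this leaves at
  least the factor n^2 below n^18 that makes Markov bounds summable. Restarting the estimates in
  each block forgets early failures, so control of all but finitely many blocks is enough.\<close>

section \<open>The uniform random source and its independent coordinates\<close>

abbreviation unif_seq :: "('i \<Rightarrow> real) measure" where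
  "unif_seq \<equiv> PiM UNIV (\<lambda>_. unif)"

lemma space_unif [simp]: "space unif = UNIV"
  by (simp add: unif_def)

lemma sets_unif [simp, measurable_cong]: "sets unif = sets borel"
  by (simp add: unif_def)

lemma prob_space_unif: "prob_space unif"
  unfolding unif_def by (rule prob_space_uniform_measure) auto

lemma emeasure_unif: "A \<in> sets borel \<Longrightarrow> emeasure unif A = emeasure lborel ({0..1} \<inter> A)"
  unfolding unif_def by (subst emeasure_uniform_measure) (auto simp: divide_ennreal_def)

lemma emeasure_unif_Ico:
  assumes "0 \<le> a" "a \<le> b" "b \<le> 1"
  shows "emeasure unif {a..<b} = ennreal (b - a)"
proof -
  have "{0..1} \<inter> {a..<b} = {a..<b}" using assms by auto
  then show ?thesis using assms by (simp add: emeasure_unif)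
qed

lemma AE_unif_Ico: "AE u in unif. 0 \<le> u \<and> u < 1"
proof -
  interpret prob_space unif by (rule prob_space_unif)
  have "emeasure unif {0..<1} = 1" using emeasure_unif_Ico[of 0 1] by simp
  then have "prob {0..<1} = 1" by (simp add: measure_def)
  then have "AE u in unif. u \<in> {0..<1}" by (subst AE_in_set_eq_1) auto
  then show ?thesis by auto
qed

lemma product_prob_space_unif: "product_prob_space (\<lambda>_. unif)"
  by (intro product_prob_spaceI prob_space_unif)

lemma sequence_space_unif: "sequence_space unif"
  by (simp add: sequence_space_def product_prob_space_unif)

lemma prob_space_unif_seq: "prob_space (unif_seq :: ('i \<Rightarrow> real) measure)"
  by (intro prob_space_PiM prob_space_unif)

lemma emeasure_coordinate:
  assumes "A \<in> sets borel"
  shows "emeasure unif_seq {\<omega>. \<omega> i \<in> A} = emeasure unif A"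
  using product_prob_space.emeasure_PiM_Collect_single[OF product_prob_space_unif, of i UNIV A] assms by (simp add: space_PiM)

lemma emeasure_coordinate2:
  assumes "A \<in> sets borel" "B \<in> sets borel" "i \<noteq> j"
  shows "emeasure unif_seq {\<omega>. \<omega> i \<in> A \<and> \<omega> j \<in> B} = emeasure unif A * emeasure unif B"
  using product_prob_space.emeasure_PiM_Collect[OF product_prob_space_unif, of "{i, j}" UNIV "\<lambda>k. if k = i then A else B"] assms
  by (simp add: space_PiM)

lemma indep_coordinates:
  "prob_space.indep_vars unif_seq (\<lambda>_. borel) (\<lambda>i \<omega>. \<omega> i) (UNIV :: 'i set)"
proof -
  interpret prob_space "unif_seq :: ('i \<Rightarrow> real) measure" by (rule prob_space_unif_seq)
  have "indep_vars (\<lambda>_. unif) (\<lambda>i \<omega>. \<omega> i) (UNIV :: 'i set)"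
  proof (subst indep_vars_iff_distr_eq_PiM')
    have "distr unif_seq unif_seq (\<lambda>x::'i \<Rightarrow> real. \<lambda>i\<in>UNIV. x i) = unif_seq"
      by (simp add: distr_id2 restrict_def)
    moreover have "distr unif_seq unif (\<lambda>\<omega>. \<omega> i) = unif" for i :: 'i
      by (rule distr_PiM_component) (auto simp: prob_space_unif)
    ultimately show "distr unif_seq unif_seq (\<lambda>x::'i \<Rightarrow> real. \<lambda>i\<in>UNIV. x i)
        = Pi\<^sub>M UNIV (\<lambda>i. distr unif_seq unif (\<lambda>\<omega>. \<omega> i))"
      by simp
  qed auto
  then show ?thesis
    by (simp add: indep_vars_def)
qed

section \<open>Almost sure limits and Borel-Cantelli\<close>

text \<open>Markov and Borel-Cantelli in one step: the whole series has finite expectation, so it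
  converges almost surely and its terms vanish.\<close>

lemma AE_tendsto_0_of_summable:
  fixes X :: "nat \<Rightarrow> 'a \<Rightarrow> real"
  assumes meas: "\<And>n. X n \<in> borel_measurable M" and nn: "\<And>n x. 0 \<le> X n x"
    and le: "\<And>n. (\<integral>\<^sup>+x. ennreal (X n x) \<partial>M) \<le> ennreal (c n)" and "summable c" "\<And>n. 0 \<le> c n"
  shows "AE x in M. (\<lambda>n. X n x) \<longlonglongrightarrow> 0"
proof -
  have "(\<integral>\<^sup>+x. (\<Sum>n. ennreal (X n x)) \<partial>M) = (\<Sum>n. \<integral>\<^sup>+x. ennreal (X n x) \<partial>M)"
    using meas by (intro nn_integral_suminf) auto
  also have "\<dots> \<le> (\<Sum>n. ennreal (c n))"
    by (intro suminf_le le) auto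
  also have "\<dots> < \<infinity>"
    using assms(4,5) by (simp add: suminf_ennreal_eq[OF _ summable_sums])
  finally have "AE x in M. (\<Sum>n. ennreal (X n x)) \<noteq> \<infinity>"
    using meas by (intro nn_integral_noteq_infinite) auto
  then show ?thesis
  proof eventually_elim
    case (elim x)
    then have "summable (\<lambda>n. X n x)"
      using nn by (intro summable_suminf_not_top) auto
    then show ?case by (rule summable_LIMSEQ_zero)
  qed
qed

text \<open>The second Borel-Cantelli lemma, phrased for the complements \<open>F n\<close>: a tail
  intersection has probability at most the product of the 1 - q n, hence at most exp of minus a
  divergent sum.\<close>

lemma (in prob_space) borel_cantelli_indep:
  assumes ind: "indep_events F (UNIV :: nat set)"
    and q: "\<And>n. prob (F n) \<le> 1 - q n" "\<And>n. 0 \<le> q n" "\<not> summable q"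
  shows "AE x in M. \<exists>\<^sub>\<infinity>n. x \<notin> F n"
proof -
  have ev: "F n \<in> events" for n using ind by (auto simp: indep_events_def)
  have "AE x in M. \<exists>n\<ge>N. x \<notin> F n" for N
  proof -
    have le: "prob (\<Inter>n\<in>{N..}. F n) \<le> exp (- (\<Sum>n\<in>{N..<Suc m}. q n))" if "N \<le> m" for m
    proof -
      have "prob (\<Inter>n\<in>{N..}. F n) \<le> prob (\<Inter>n\<in>{N..<Suc m}. F n)"
        using ev that by (intro finite_measure_mono) auto
      also have "\<dots> = (\<Prod>n\<in>{N..<Suc m}. prob (F n))"
        using ind that unfolding indep_events_def by auto
      also have "\<dots> \<le> (\<Prod>n\<in>{N..<Suc m}. exp (- q n))"
      proof (intro prod_mono conjI)
        fix n
        show "prob (F n) \<le> exp (- q n)"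
          using q(1)[of n] exp_ge_add_one_self[of "- q n"] by linarith
      qed auto
      also have "\<dots> = exp (- (\<Sum>n\<in>{N..<Suc m}. q n))"
        by (simp only: exp_sum finite_atLeastLessThan flip: sum_negf)
      finally show ?thesis .
    qed
    have "prob (\<Inter>n\<in>{N..}. F n) \<le> 0"
    proof (rule ccontr)
      assume "\<not> ?thesis"
      then obtain d where d: "d = prob (\<Inter>n\<in>{N..}. F n)" "d > 0" by auto
      have "(\<Sum>n\<in>{N..<Suc m}. q n) \<le> - ln d" if "N \<le> m" for m
        using le[OF that] d by (metis add.inverse_inverse exp_le_cancel_iff exp_ln neg_le_iff_le)
      \<comment> \<open>The \<open>max 0\<close> covers the empty sums, m \<le> N.\<close>
      then have b: "(\<Sum>n\<in>{N..<m}. q n) \<le> max 0 (- ln d)" for m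
        by (cases m) (fastforce simp: not_le max_def)+
      have "summable (\<lambda>n. q (n + N))"
      proof (rule bounded_imp_summable)
        fix n
        have "(\<Sum>k\<le>n. q (k + N)) = (\<Sum>k\<in>{N..<Suc n + N}. q k)"
          using sum.shift_bounds_nat_ivl[of q 0 N "Suc n"]
          by (simp add: atLeast0LessThan lessThan_Suc_atMost)
        then show "(\<Sum>k\<le>n. q (k + N)) \<le> max 0 (- ln d)"
          using b[of "Suc n + N"] by simp
      qed (auto simp: q)
      then show False using q(3) by (simp add: summable_iff_shift)
    qed
    then have "prob (\<Inter>n\<in>{N..}. F n) = 0"
      using measure_nonneg[of M] by (simp add: antisym)
    moreover have "(\<Inter>n\<in>{N..}. F n) \<in> events"
      using ev by (intro sets.countable_INT') auto
    ultimately have "(\<Inter>n\<in>{N..}. F n) \<in> null_sets M"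
      by (simp add: emeasure_eq_measure null_sets_def)
    then have "AE x in M. x \<notin> (\<Inter>n\<in>{N..}. F n)" by (rule AE_not_in)
    then show ?thesis by eventually_elim auto
  qed
  then have "AE x in M. \<forall>N. \<exists>n\<ge>N. x \<notin> F n" by (simp add: AE_all_countable)
  then show ?thesis by (simp add: INFM_nat_le)
qed

text \<open>A joint action is forced by two random numbers at once, one for each player. Disjoint
  pairs of coordinates are independent, so Borel-Cantelli applies to the pairs.\<close>

lemma AE_infinitely_often_coordinate_pairs:
  fixes i j :: "nat \<Rightarrow> 'i"
  assumes dist: "\<And>k. i k \<noteq> j k" "disjoint_family (\<lambda>k. {i k, j k})"
    and sets: "\<And>k. A k \<in> sets borel" "\<And>k. B k \<in> sets borel"
    and q: "\<And>k. ennreal (q k) \<le> emeasure unif (A k) * emeasure unif (B k)"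
      "\<And>k. 0 \<le> q k" "\<not> summable q"
  shows "AE \<omega> in unif_seq. \<exists>\<^sub>\<infinity>k. \<omega> (i k) \<in> A k \<and> \<omega> (j k) \<in> B k"
proof -
  interpret prob_space "unif_seq :: ('i \<Rightarrow> real) measure" by (rule prob_space_unif_seq)
  let ?E = "\<lambda>k. {\<omega>. \<omega> (i k) \<in> A k \<and> \<omega> (j k) \<in> B k}"
  have sp: "space (unif_seq :: ('i \<Rightarrow> real) measure) = UNIV" by (simp add: space_PiM)
  have "indep_vars (\<lambda>k. PiM {i k, j k} (\<lambda>_. borel))
      (\<lambda>k \<omega>. restrict (\<lambda>l. \<omega> l) {i k, j k}) (UNIV :: nat set)"
    using dist by (intro indep_vars_restrict[OF indep_coordinates]) auto
  from indep_eventsI_indep_vars[OF this, of "\<lambda>k x. \<not> (x (i k) \<in> A k \<and> x (j k) \<in> B k)"]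
  have "indep_events (\<lambda>k. {\<omega>. \<not> (\<omega> (i k) \<in> A k \<and> \<omega> (j k) \<in> B k)}) (UNIV :: nat set)"
    using sets by (simp add: sp)
  moreover have Emeas: "?E k \<in> events" for k
  proof -
    have "Measurable.pred unif_seq (\<lambda>\<omega>. \<omega> (i k) \<in> A k \<and> \<omega> (j k) \<in> B k)"
      using sets by measurable
    then show ?thesis by (simp add: pred_def sp)
  qed
  have compl: "{\<omega>. \<not> (\<omega> (i k) \<in> A k \<and> \<omega> (j k) \<in> B k)} = space unif_seq - ?E k" for k
    by (auto simp: sp)
  have "prob {\<omega>. \<not> (\<omega> (i k) \<in> A k \<and> \<omega> (j k) \<in> B k)} \<le> 1 - q k" for k
  proof -
    have "ennreal (q k) \<le> emeasure unif_seq (?E k)"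
      using q(1)[of k] emeasure_coordinate2[OF sets dist(1), of k k k] by simp
    then have "q k \<le> prob (?E k)" using q(2) by (simp add: emeasure_eq_measure)
    then show ?thesis unfolding compl by (simp only: prob_compl[OF Emeas])
  qed
  ultimately have "AE x in unif_seq. \<exists>\<^sub>\<infinity>n. x \<notin> {\<omega>. \<not> (\<omega> (i n) \<in> A n \<and> \<omega> (j n) \<in> B n)}"
    using q by (intro borel_cantelli_indep) auto
  then show ?thesis by simp
qed

section \<open>Markov chains driven by independent uniform numbers\<close>

primrec chain :: "('a \<Rightarrow> real \<Rightarrow> 'a) \<Rightarrow> 'a \<Rightarrow> (nat \<Rightarrow> real) \<Rightarrow> nat \<Rightarrow> 'a" where
  "chain f s \<omega> 0 = s"
| "chain f s \<omega> (Suc t) = f (chain f s \<omega> t) (\<omega> t)"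

lemma chain_Suc_shift: "chain f s \<omega> (Suc t) = chain f (f s (\<omega> 0)) (\<lambda>i. \<omega> (Suc i)) t"
  by (induction t) simp_all

lemma measurable_chain:
  fixes f :: "'a::countable \<Rightarrow> real \<Rightarrow> 'a"
  assumes f: "\<And>s. f s \<in> borel \<rightarrow>\<^sub>M count_space UNIV"
  shows "(\<lambda>\<omega>. chain f s \<omega> t) \<in> unif_seq \<rightarrow>\<^sub>M count_space UNIV"
proof (induction t)
  case (Suc t)
  have "(\<lambda>\<omega>. f s' (\<omega> t)) \<in> unif_seq \<rightarrow>\<^sub>M count_space UNIV" for s'
    by (rule measurable_compose[OF _ f]) simp
  then show ?case
    using measurable_compose_countable[OF _ Suc, of "\<lambda>s' \<omega>. f s' (\<omega> t)"] by simp
qed simp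

text \<open>A supermartingale bound without conditional expectations. The first random number is
  split off, not the last: the tail is again an independent uniform sequence and the chain continues
  from \<open>f s u\<close>, which is why the induction generalises over the start.\<close>

lemma nn_integral_chain_le:
  fixes f :: "'a::countable \<Rightarrow> real \<Rightarrow> 'a" and W :: "nat \<Rightarrow> 'a \<Rightarrow> ennreal"
  assumes f: "\<And>s. f s \<in> borel \<rightarrow>\<^sub>M count_space UNIV"
    and step: "\<And>t s. (\<integral>\<^sup>+u. W (Suc t) (f s u) \<partial>unif) \<le> W t s + c t"
  shows "(\<integral>\<^sup>+\<omega>. W (t0 + t) (chain f s \<omega> t) \<partial>unif_seq) \<le> W t0 s + (\<Sum>i<t. c (t0 + i))"
proof (induction t arbitrary: t0 s)
  case 0
  interpret prob_space "unif_seq :: (nat \<Rightarrow> real) measure" by (rule prob_space_unif_seq)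
  show ?case by (simp add: emeasure_space_1)
next
  case (Suc t)
  interpret prob_space unif by (rule prob_space_unif)
  interpret S: prob_space "unif_seq :: (nat \<Rightarrow> real) measure" by (rule prob_space_unif_seq)
  interpret pair_sigma_finite unif "unif_seq :: (nat \<Rightarrow> real) measure" ..
  let ?h = "\<lambda>\<omega>. W (t0 + Suc t) (chain f s \<omega> (Suc t))"
  have h [measurable]: "?h \<in> borel_measurable unif_seq"
    by (rule measurable_compose[OF measurable_chain[OF f]]) simp
  have g: "(\<lambda>(u, \<omega>). case_nat u \<omega>) \<in> unif \<Otimes>\<^sub>M unif_seq \<rightarrow>\<^sub>M unif_seq"
    by measurable
  have "(\<integral>\<^sup>+\<omega>. ?h \<omega> \<partial>unif_seq)
      = (\<integral>\<^sup>+\<omega>. ?h \<omega> \<partial>distr (unif \<Otimes>\<^sub>M unif_seq) unif_seq (\<lambda>(u, \<omega>). case_nat u \<omega>))"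
    by (simp only: sequence_space.PiM_iter[OF sequence_space_unif])
  also have "\<dots> = (\<integral>\<^sup>+p. ?h ((\<lambda>(u, \<omega>). case_nat u \<omega>) p) \<partial>(unif \<Otimes>\<^sub>M unif_seq))"
    by (rule nn_integral_distr[OF g]) (unfold measurable_distr_eq1, rule h)
  also have "\<dots> = (\<integral>\<^sup>+u. \<integral>\<^sup>+\<omega>. ?h (case_nat u \<omega>) \<partial>unif_seq \<partial>unif)"
    using measurable_compose[OF g h]
    by (subst S.nn_integral_fst[symmetric]) (auto simp: case_prod_beta' simp del: chain.simps)
  also have "\<dots> = (\<integral>\<^sup>+u. \<integral>\<^sup>+\<omega>. W (Suc t0 + t) (chain f (f s u) \<omega> t) \<partial>unif_seq \<partial>unif)"
    by (simp only: chain_Suc_shift nat.case add_Suc_right add_Suc)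
  also have "\<dots> \<le> (\<integral>\<^sup>+u. W (Suc t0) (f s u) + (\<Sum>i<t. c (Suc t0 + i)) \<partial>unif)"
    by (intro nn_integral_mono Suc.IH)
  also have "\<dots> = (\<integral>\<^sup>+u. W (Suc t0) (f s u) \<partial>unif) + (\<Sum>i<t. c (Suc t0 + i))"
    using measurable_compose[OF f, of "W (Suc t0)" borel s]
    by (subst nn_integral_add) (auto simp: emeasure_space_1[simplified])
  also have "\<dots> \<le> W t0 s + c t0 + (\<Sum>i<t. c (Suc t0 + i))"
    by (intro add_mono step) auto
  also have "\<dots> = W t0 s + (\<Sum>i<Suc t. c (t0 + i))"
    by (simp add: sum.lessThan_Suc_shift add.assoc del: sum.lessThan_Suc)
  finally show ?case .
qed

section \<open>Block schedule\<close>

text \<open>The integer part of the 20th root: block n is the time interval from n^20 up to, but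
  excluding, (n+1)^20.\<close>

definition blk :: "nat \<Rightarrow> nat" where
  "blk t = (LEAST n. t < Suc n ^ 20)"

lemma blk_eqI:
  assumes "n ^ 20 \<le> t" "t < Suc n ^ 20"
  shows "blk t = n"
  unfolding blk_def
proof (rule Least_equality)
  fix m assume "t < Suc m ^ 20"
  with assms(1) have "n ^ 20 < Suc m ^ 20" by linarith
  then show "n \<le> m" using power_less_imp_less_base[of n 20 "Suc m"] by simp
qed (rule assms)

lemma blk_bounds: "blk t ^ 20 \<le> t" "t < Suc (blk t) ^ 20"
proof -
  have ex: "t < Suc t ^ 20" using self_le_power[of "Suc t" 20] by simp
  show "t < Suc (blk t) ^ 20" unfolding blk_def using LeastI[of "\<lambda>n. t < Suc n ^ 20", OF ex] .
  show "blk t ^ 20 \<le> t"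
  proof (cases "blk t")
    case (Suc n)
    then show ?thesis using not_less_Least[of n "\<lambda>n. t < Suc n ^ 20"] by (simp add: blk_def not_less)
  qed simp
qed

lemma blk_ge: "n ^ 20 \<le> t \<Longrightarrow> n \<le> blk t"
  using blk_bounds(2)[of t] power_less_imp_less_base[of n 20 "Suc (blk t)"] by simp

definition block_len :: "nat \<Rightarrow> real" where
  "block_len n = real (Suc n) ^ 20 - real n ^ 20"

lemma block_len_ge: "real (Suc n) ^ 19 \<le> block_len n"
proof -
  have p: "x ^ 20 = x * x ^ 19" for x :: real
    using power_Suc[of x 19] by simp
  have "real n * real n ^ 19 \<le> real n * real (Suc n) ^ 19"
    by (intro mult_left_mono power_mono) auto
  then show ?thesis unfolding block_len_def p by (simp add: distrib_right)
qed

lemma block_len_le: "block_len n \<le> 20 * real (Suc n) ^ 19"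
proof -
  have "block_len n = (real (Suc n) - real n) * (\<Sum>i<20. real n ^ (20 - Suc i) * real (Suc n) ^ i)"
    unfolding block_len_def by (rule power_diff_sumr2)
  also have "\<dots> = (\<Sum>i<20. real n ^ (20 - Suc i) * real (Suc n) ^ i)" by simp
  also have "\<dots> \<le> (\<Sum>i<(20::nat). real (Suc n) ^ 19)"
  proof (rule sum_mono)
    fix i :: nat assume "i \<in> {..<20}"
    then have "real (Suc n) ^ 19 = real (Suc n) ^ (20 - Suc i) * real (Suc n) ^ i"
      by (simp only: power_add[symmetric]) simp
    then show "real n ^ (20 - Suc i) * real (Suc n) ^ i \<le> real (Suc n) ^ 19"
      by (simp only:) (intro mult_right_mono power_mono, auto)
  qed
  finally show ?thesis by simp
qed

text \<open>The root player (four arms) explores at a higher rate: the weight 1 / rate of his observations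
  has to be dominated by the rarity of the exploration steps in the inner game.\<close>

definition rate :: "nat \<Rightarrow> nat \<Rightarrow> real" where
  "rate K n = 1 / real (n + 2) ^ (if K = 4 then 4 else 10)"

text \<open>One power below the length of the block, so that an estimate of this size is harmless,
  but above both the square root of the accumulated variance, of order n^14.5, and the total effect
  of the deviations in self-play.\<close>

definition thr :: "nat \<Rightarrow> real" where
  "thr n = real (Suc n) ^ 18"

lemma rate_pos: "0 < rate K n"
  by (simp add: rate_def)

lemma rate_le_half: "rate K n \<le> 1 / 2"
proof -
  have "(2::real) ^ 1 \<le> real (n + 2) ^ (if K = 4 then 4 else 10)"
    by (rule order_trans[OF power_increasing power_mono]) auto
  then show ?thesis unfolding rate_def by (intro divide_left_mono) auto
qed

lemma rate_ge: "1 / real (n + 2) ^ 10 \<le> rate K n"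
  unfolding rate_def by (intro divide_left_mono power_increasing) auto

lemma rate_le: "rate K n \<le> 1 / real (n + 2)"
proof -
  have "real (n + 2) ^ 1 \<le> real (n + 2) ^ (if K = 4 then 4 else 10)"
    by (rule power_increasing) auto
  then show ?thesis unfolding rate_def by (intro divide_left_mono) auto
qed

lemma thr_pos: "0 < thr n" by (simp add: thr_def)

section \<open>Sampling\<close>

definition sample :: "(nat \<Rightarrow> real) \<Rightarrow> real \<Rightarrow> nat" where
  "sample q u = (LEAST j. u < (\<Sum>i\<le>j. q i))"

lemma measurable_sample: "sample q \<in> borel \<rightarrow>\<^sub>M count_space UNIV"
  unfolding sample_def by measurable

lemma sample_eq:
  assumes "\<And>i. 0 \<le> q i" "(\<Sum>i<j. q i) \<le> u" "u < (\<Sum>i\<le>j. q i)"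
  shows "sample q u = j"
  unfolding sample_def
proof (rule Least_equality)
  fix k assume k: "u < (\<Sum>i\<le>k. q i)"
  show "j \<le> k"
  proof (rule ccontr)
    assume "\<not> ?thesis"
    then have "(\<Sum>i\<le>k. q i) \<le> (\<Sum>i<j. q i)"
      using assms(1) by (intro sum_mono2) auto
    with k assms(2) show False by linarith
  qed
qed (rule assms)

text \<open>Up to a null set, [0,1) is tiled by intervals of length \<open>q j\<close> on which the
  sample is j. Outside of [0,1), where \<open>LEAST\<close> may be unspecified, nothing is
  claimed.\<close>

lemma nn_integral_sample_le:
  fixes F :: "nat \<Rightarrow> ennreal"
  assumes q: "\<And>i. 0 \<le> q i" and tot: "(\<Sum>i<n. q i) = 1"
  shows "(\<integral>\<^sup>+u. F (sample q u) \<partial>unif) \<le> (\<Sum>j<n. ennreal (q j) * F j)"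
proof -
  let ?I = "\<lambda>j. {(\<Sum>i<j. q i)..<(\<Sum>i\<le>j. q i)}"
  have I: "emeasure unif (?I j) = ennreal (q j)" if "j < n" for j
  proof -
    have "(\<Sum>i\<le>j. q i) \<le> (\<Sum>i<n. q i)" using that q by (intro sum_mono2) auto
    moreover have e: "(\<Sum>i\<le>j. q i) = (\<Sum>i<j. q i) + q j"
      by (simp add: lessThan_Suc_atMost[symmetric])
    moreover have "0 \<le> (\<Sum>i<j. q i)" using q by (intro sum_nonneg)
    ultimately show ?thesis using q[of j] tot by (subst emeasure_unif_Ico) auto
  qed
  have "(\<integral>\<^sup>+u. F (sample q u) \<partial>unif) \<le> (\<integral>\<^sup>+u. (\<Sum>j<n. F j * indicator (?I j) u) \<partial>unif)"
  proof (rule nn_integral_mono_AE)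
    show "AE u in unif. F (sample q u) \<le> (\<Sum>j<n. F j * indicator (?I j) u)"
      using AE_unif_Ico
    proof eventually_elim
      case (elim u)
      define j where "j = (LEAST j. u < (\<Sum>i\<le>j. q i))"
      have "n \<noteq> 0" using tot by (cases n) auto
      then have "u < (\<Sum>i\<le>n - 1. q i)" using elim tot
        by (metis Suc_pred' lessThan_Suc_atMost neq0_conv)
      then have j1: "u < (\<Sum>i\<le>j. q i)" and "j \<le> n - 1"
        unfolding j_def by (rule LeastI, rule Least_le)
      then have jn: "j < n" using \<open>n \<noteq> 0\<close> by simp
      have j2: "(\<Sum>i<j. q i) \<le> u"
      proof (cases j)
        case (Suc m)
        then show ?thesis using not_less_Least[of m "\<lambda>j. u < (\<Sum>i\<le>j. q i)"]
          by (simp add: j_def lessThan_Suc_atMost not_less)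
      qed (use elim in simp)
      have "F (sample q u) = F j * indicator (?I j) u"
        using j1 j2 sample_eq[OF q j2 j1] by simp
      also have "\<dots> \<le> (\<Sum>j<n. F j * indicator (?I j) u)"
        using jn by (intro member_le_sum) auto
      finally show ?case .
    qed
  qed
  also have "\<dots> = (\<Sum>j<n. \<integral>\<^sup>+u. F j * indicator (?I j) u \<partial>unif)"
    by (intro nn_integral_sum) auto
  also have "\<dots> = (\<Sum>j<n. ennreal (q j) * F j)"
    by (intro sum.cong refl, subst nn_integral_cmult_indicator) (simp_all add: I mult.commute)
  finally show ?thesis .
qed

section \<open>The algorithm\<close>

type_synonym hist = "(nat \<times> real) list"

text \<open>The roles of the self-play are told apart by the number of arms: 2 and 3 for the players of the
  inner game, 4 for player 1 at the root.  There, an odd number of visits of the inner game means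
  that its next value is predicted to be 1, as the very first visit only adds it to the tree.\<close>

definition zeros :: "hist \<Rightarrow> nat" where
  "zeros r = length (filter (\<lambda>y. fst y = 0) r)"

text \<open>Matching pennies in which the arms 1 and 2 of player 2 are copies of each other; the
  copy gives him a number of arms different from that of his opponent.\<close>

definition pay :: "nat \<Rightarrow> nat \<Rightarrow> real" where
  "pay i j = of_bool ((i = 0) = (j = 0))"

text \<open>The inner players repeat 0,0,1,1 and 0,1,1,0, which match at every other step. At the
  root, arm 0 enters and arm 1 waits: an entry at a multiple of 16 that makes the count odd forces a
  second entry, which gives 2 entries in 16 steps.\<close>

definition pat :: "nat \<Rightarrow> hist \<Rightarrow> nat" where
  "pat K r =
     (if K = 2 then (length r mod 4) div 2
      else if K = 3 then of_bool (length r mod 4 \<in> {1, 2})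
      else if K = 4 then of_bool (\<not> (odd (zeros r) \<or> 16 dvd length r))
      else 0)"

text \<open>The reward of each arm if the inner players keep to their patterns. A player can compute
  it from his own history, because the inner patterns depend on its length only and the root
  prediction on the parity of the entries. For all other numbers of arms the prediction is 0, and
  the estimate below becomes plain importance weighting.\<close>

definition pred :: "nat \<Rightarrow> hist \<Rightarrow> nat \<Rightarrow> real" where
  "pred K r k =
     (if K = 2 then pay k (pat 3 r)
      else if K = 3 then 1 - pay (pat 2 r) k
      else of_bool (K = 4 \<and> k = 0 \<and> odd (zeros r)))"

lemma pat_less: "0 < K \<Longrightarrow> pat K r < K"
  by (auto simp: pat_def)

lemma pred_bounds: "0 \<le> pred K r k" "pred K r k \<le> 1"
  by (auto simp: pred_def pay_def)

definition mix :: "nat \<Rightarrow> hist \<Rightarrow> (nat \<Rightarrow> real) \<Rightarrow> nat \<Rightarrow> real" where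
  "mix K r e k =
     (let \<theta> = thr (blk (length r)) in
      if \<forall>j<K. e j \<le> \<theta> then of_bool (k = pat K r)
      else max 0 (e k - \<theta>) / (\<Sum>j<K. max 0 (e j - \<theta>)))"

definition arm_prob :: "nat \<Rightarrow> hist \<Rightarrow> (nat \<Rightarrow> real) \<Rightarrow> nat \<Rightarrow> real" where
  "arm_prob K r e k =
     (let g = rate K (blk (length r)) in g / real K + (1 - g) * mix K r e k)"

text \<open>Unbiased for every prediction, and free of noise if the prediction is correct.\<close>

definition gain_est :: "nat \<Rightarrow> hist \<Rightarrow> (nat \<Rightarrow> real) \<Rightarrow> nat \<times> real \<Rightarrow> nat \<Rightarrow> real" where
  "gain_est K r e y k =
     pred K r k + of_bool (fst y = k) * (snd y - pred K r k) / arm_prob K r e k"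

text \<open>Applied on reading, when the next decision opens a block. The stored value thus still
  shows the total of a finished block at the moment when the block ends, which is where the
  potential is evaluated.\<close>

definition restart :: "nat \<Rightarrow> (nat \<Rightarrow> real) \<Rightarrow> nat \<Rightarrow> real" where
  "restart t e = (if blk t ^ 20 = t then (\<lambda>_. 0) else e)"

text \<open>Histories are stored with the latest observation first.\<close>

primrec est :: "nat \<Rightarrow> hist \<Rightarrow> nat \<Rightarrow> real" where
  "est K [] = (\<lambda>_. 0)"
| "est K (y # r) =
     (\<lambda>k. restart (length r) (est K r) k
        + (gain_est K r (restart (length r) (est K r)) y k - snd y - rate K (blk (length r))))"

abbreviation cur :: "nat \<Rightarrow> hist \<Rightarrow> nat \<Rightarrow> real" where
  "cur K r \<equiv> restart (length r) (est K r)"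

text \<open>The exploration part comes first, so that its intervals in the inverse transform sampling
  do not depend on the history.\<close>

definition wts :: "nat \<Rightarrow> hist \<Rightarrow> nat \<Rightarrow> real" where
  "wts K r j =
     (let g = rate K (blk (length r)) in
      if j < K then g / real K else if j < 2 * K then (1 - g) * mix K r (cur K r) (j - K) else 0)"

text \<open>The weights have two slots for every arm, j for exploration and K + j for the mixture;
  \<open>mod K\<close> merges them. It also keeps the choice below K for numbers u outside [0,1),
  where \<open>sample\<close> may be unspecified.\<close>

definition alg :: bandit_alg where
  "alg K h u = sample (wts K (rev h)) u mod K"

lemma valid_alg_alg: "valid_alg alg"
  unfolding valid_alg_def
proof safe
  fix K h
  have "(\<lambda>u. (\<lambda>j. j mod K) (sample (wts K (rev h)) u)) \<in> borel \<rightarrow>\<^sub>M count_space UNIV"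
    by (rule measurable_compose[OF measurable_sample]) simp
  then show "alg K h \<in> borel_measurable borel"
    unfolding alg_def by (rule measurable_compose) simp
qed (simp add: alg_def)

lemma mix_nonneg: "0 \<le> mix K r e k"
  unfolding mix_def Let_def by (auto intro!: divide_nonneg_nonneg sum_nonneg)

lemma sum_mix:
  assumes "0 < K"
  shows "(\<Sum>k<K. mix K r e k) = 1"
proof (cases "\<forall>j<K. e j \<le> thr (blk (length r))")
  case True
  then have "(\<Sum>k<K. mix K r e k) = (\<Sum>k<K. if k = pat K r then 1 else 0)"
    by (intro sum.cong) (auto simp: mix_def)
  also have "\<dots> = 1" using pat_less[OF assms, of r] by (subst sum.delta) auto
  finally show ?thesis .
next
  case False
  then obtain j where j: "j < K" "thr (blk (length r)) < e j" by (auto simp: not_le)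
  have "0 < max 0 (e j - thr (blk (length r)))" using j by simp
  also have "\<dots> \<le> (\<Sum>j<K. max 0 (e j - thr (blk (length r))))"
    using j by (intro member_le_sum) auto
  finally show ?thesis using False unfolding mix_def Let_def
    by (simp only: if_False sum_divide_distrib[symmetric]) simp
qed

lemma arm_prob_ge: "rate K (blk (length r)) / real K \<le> arm_prob K r e k"
  using mix_nonneg[of K r e k] rate_le_half[of K "blk (length r)"]
  by (simp add: arm_prob_def Let_def)

lemma arm_prob_pos: "0 < K \<Longrightarrow> 0 < arm_prob K r e k"
  using arm_prob_ge[of K r e k] rate_pos[of K "blk (length r)"]
  by (smt (verit) divide_pos_pos of_nat_0_less_iff)

lemma sum_arm_prob: "0 < K \<Longrightarrow> (\<Sum>k<K. arm_prob K r e k) = 1"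
  using sum_mix[of K r e]
  by (simp add: arm_prob_def Let_def sum.distrib flip: sum_distrib_left)

lemma wts_nonneg: "0 \<le> wts K r j"
  using rate_pos[of K "blk (length r)"] rate_le_half[of K "blk (length r)"] mix_nonneg
  by (auto simp: wts_def Let_def)

lemma sum_lessThan_add:
  fixes G :: "nat \<Rightarrow> 'a::comm_monoid_add"
  shows "(\<Sum>j<n + m. G j) = (\<Sum>j<n. G j) + (\<Sum>j<m. G (n + j))"
  by (induction m) (simp_all add: add.assoc)

section \<open>One step of regret matching with estimated gains\<close>

lemma pos_part_sq_step:
  fixes y z :: real
  shows "(max 0 (y + z))\<^sup>2 \<le> (max 0 y)\<^sup>2 + 2 * max 0 y * z + z\<^sup>2"
proof (cases "0 \<le> y")
  case True
  then have "(max 0 (y + z))\<^sup>2 \<le> (y + z)\<^sup>2" by (auto simp: max_def)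
  with True show ?thesis by (simp add: power2_sum)
next
  case False
  then have "(max 0 (y + z))\<^sup>2 \<le> z\<^sup>2" by (intro abs_le_square_iff[THEN iffD1]) auto
  with False show ?thesis by simp
qed

lemma square_add_le: "(b + c)\<^sup>2 \<le> 2 * b\<^sup>2 + 2 * c\<^sup>2" for b c :: real
  using zero_le_power2[of "b - c"] by (simp add: power2_eq_square algebra_simps)

text \<open>Blackwell's quadratic potential for the excess over \<theta>, joined with the square of
  the estimation error d, whose increments have mean 0. The factor S is 0 below the threshold, so
  there m may be anything, in particular the pattern, without raising the potential to first order.
  The constant is 10 for the second moment of the regret increment plus 1 for that of the error
  increment.\<close>

lemma regret_matching_step:
  fixes p m x \<pi> e d :: "nat \<Rightarrow> real"
  assumes K: "0 < K" and g: "0 < g" "g \<le> 1" and m: "\<And>k. 0 \<le> m k" "(\<Sum>k<K. m k) = 1"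
    and p: "\<And>k. p k = g / real K + (1 - g) * m k"
    and x: "\<And>k. 0 \<le> x k" "\<And>k. x k \<le> 1" and \<pi>: "\<And>k. 0 \<le> \<pi> k" "\<And>k. \<pi> k \<le> 1"
    and S: "0 \<le> S" "\<And>k. k < K \<Longrightarrow> max 0 (e k - \<theta>) = S * m k"
  shows "(\<Sum>a<K. p a * (\<Sum>k<K.
             (max 0 (e k + (\<pi> k + of_bool (a = k) * (x a - \<pi> k) / p k - x a - g) - \<theta>))\<^sup>2
           + (d k + (x k - (\<pi> k + of_bool (a = k) * (x a - \<pi> k) / p k)))\<^sup>2))
         \<le> (\<Sum>k<K. (max 0 (e k - \<theta>))\<^sup>2 + (d k)\<^sup>2) + 11 * (real K)\<^sup>2 / g"
proof -
  define \<delta> where "\<delta> a k = \<pi> k + of_bool (a = k) * (x a - \<pi> k) / p k - x a - g" for a k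
  define \<zeta> where "\<zeta> a k = x k - (\<pi> k + of_bool (a = k) * (x a - \<pi> k) / p k)" for a k
  define X where "X = (\<Sum>a<K. p a * x a)"
  have pge: "g / real K \<le> p k" for k using g m(1)[of k] by (simp add: p)
  have ppos: "0 < p k" for k using pge[of k] g K by (smt (verit) divide_pos_pos of_nat_0_less_iff)
  have pinv: "1 / p k \<le> real K / g" for k
    using divide_left_mono[OF pge[of k], of 1] g K ppos[of k] by simp
  have sp: "(\<Sum>a<K. p a) = 1"
    using K m(2) by (simp add: p sum.distrib flip: sum_distrib_left)
  \<comment> \<open>Importance weighting: only a = k survives, and there p a cancels 1 / p
    k.\<close>
  have sel: "(\<Sum>a<K. p a * (of_bool (a = k) * c a / p k)) = c k" if "k < K" for c k
  proof -
    have "(\<Sum>a<K. p a * (of_bool (a = k) * c a / p k)) = (\<Sum>a<K. if a = k then c a else 0)"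
      using ppos[THEN less_imp_neq] by (intro sum.cong) auto
    then show ?thesis using that by simp
  qed
  have d1: "(\<Sum>a<K. p a * \<delta> a k) = x k - X - g" if k: "k < K" for k
  proof -
    have "(\<Sum>a<K. p a * \<delta> a k) = (\<Sum>a<K. p a * \<pi> k
        + p a * (of_bool (a = k) * (x a - \<pi> k) / p k) - p a * x a - p a * g)"
      by (intro sum.cong) (auto simp: \<delta>_def algebra_simps)
    also have "\<dots> = \<pi> k + (x k - \<pi> k) - X - g"
      using sel[OF k, of "\<lambda>a. x a - \<pi> k"] sp
      by (simp add: sum.distrib sum_subtractf X_def flip: sum_distrib_right)
    finally show ?thesis by simp
  qed
  \<comment> \<open>The increment is an importance-weighted part b plus a rest of size at most 2. By
    (b + c)^2 \<le> 2 b^2 + 2 c^2 this costs 8 plus twice the mean 1 / p k of the bound on b^2, and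
    both 1 and 1 / p k are at most K / g.\<close>
  have d2: "(\<Sum>a<K. p a * (\<delta> a k)\<^sup>2) \<le> 10 * real K / g" if k: "k < K" for k
  proof -
    have "(\<delta> a k)\<^sup>2 \<le> 8 + of_bool (a = k) * (2 / p k) / p k" for a
    proof -
      define b where "b = of_bool (a = k) * (x a - \<pi> k) / p k"
      have "b\<^sup>2 = of_bool (a = k) * ((x a - \<pi> k)\<^sup>2 / (p k)\<^sup>2)"
        by (simp add: b_def power_divide)
      also have "\<dots> \<le> of_bool (a = k) * (1 / (p k)\<^sup>2)"
      proof -
        have "\<bar>x a - \<pi> k\<bar> \<le> 1" using x[of a] \<pi>[of k] by linarith
        then have "(x a - \<pi> k)\<^sup>2 \<le> 1" by (simp add: abs_square_le_1)
        then show ?thesis by (intro mult_left_mono divide_right_mono) auto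
      qed
      finally have b: "b\<^sup>2 \<le> of_bool (a = k) * (1 / (p k)\<^sup>2)" .
      have "\<bar>\<pi> k - x a - g\<bar> \<le> 2" using x[of a] \<pi>[of k] g by linarith
      then have "(\<pi> k - x a - g)\<^sup>2 \<le> 4"
        using abs_le_square_iff[of "\<pi> k - x a - g" 2] by simp
      moreover have "(b + (\<pi> k - x a - g))\<^sup>2 \<le> 2 * b\<^sup>2 + 2 * (\<pi> k - x a - g)\<^sup>2"
        by (rule square_add_le)
      moreover have "(\<delta> a k)\<^sup>2 = (b + (\<pi> k - x a - g))\<^sup>2"
        by (rule arg_cong[where f = "\<lambda>v. v\<^sup>2"]) (simp add: \<delta>_def b_def)
      ultimately have "(\<delta> a k)\<^sup>2 \<le> 8 + 2 * (of_bool (a = k) * (1 / (p k)\<^sup>2))"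
        using b by linarith
      then show ?thesis by (cases "a = k") (simp_all add: power2_eq_square)
    qed
    then have "(\<Sum>a<K. p a * (\<delta> a k)\<^sup>2) \<le> (\<Sum>a<K. p a * (8 + of_bool (a = k) * (2 / p k) / p k))"
      using ppos by (intro sum_mono mult_left_mono) (auto intro: less_imp_le)
    also have "\<dots> = 8 + 2 / p k"
      using sel[OF k, of "\<lambda>_. 2 / p k"] sp
      by (simp add: distrib_left sum.distrib flip: sum_distrib_right)
    also have "\<dots> \<le> 8 * (real K / g) + 2 * (real K / g)"
    proof (intro add_mono)
      have "1 * g \<le> real K * 1" using K g by (intro mult_mono) auto
      then show "8 \<le> 8 * (real K / g)" using g by (simp add: field_simps)
    qed (use pinv[of k] in simp)
    finally show ?thesis by simp
  qed
  have z1: "(\<Sum>a<K. p a * \<zeta> a k) = 0" if k: "k < K" for k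
  proof -
    have "(\<Sum>a<K. p a * \<zeta> a k) = (\<Sum>a<K. p a * (x k - \<pi> k)
        - p a * (of_bool (a = k) * (x a - \<pi> k) / p k))"
      by (intro sum.cong) (auto simp: \<zeta>_def algebra_simps)
    also have "\<dots> = 0"
      using sel[OF k, of "\<lambda>a. x a - \<pi> k"] sp
      by (simp add: sum_subtractf flip: sum_distrib_right)
    finally show ?thesis .
  qed
  have z2: "(\<Sum>a<K. p a * (\<zeta> a k)\<^sup>2) \<le> real K / g" if k: "k < K" for k
  proof -
    let ?v = "(x k - \<pi> k)\<^sup>2"
    have "p a * (\<zeta> a k)\<^sup>2 = p a * ?v + p a * (of_bool (a = k) * (?v * (1 / p k - 2)) / p k)" for a
      using ppos[of k] by (cases "a = k") (auto simp: \<zeta>_def field_simps power2_eq_square)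
    then have "(\<Sum>a<K. p a * (\<zeta> a k)\<^sup>2) = ?v + ?v * (1 / p k - 2)"
      using sel[OF k, of "\<lambda>_. ?v * (1 / p k - 2)"] sp
      by (simp add: sum.distrib flip: sum_distrib_right)
    also have "\<dots> \<le> ?v * (1 / p k)" by (simp add: algebra_simps)
    also have "\<dots> \<le> 1 * (real K / g)"
    proof (intro mult_mono pinv)
      have "\<bar>x k - \<pi> k\<bar> \<le> 1" using x[of k] \<pi>[of k] by linarith
      then show "?v \<le> 1" by (simp add: abs_square_le_1)
    qed (use ppos[of k] in auto)
    finally show ?thesis by simp
  qed
  \<comment> \<open>Exploration lowers the expected reward X below the reward Y of the mixture by at
    most g * Y \<le> g. Subtracting the rate g in every estimate absorbs this loss.\<close>
  have drift: "(\<Sum>k<K. max 0 (e k - \<theta>) * (x k - X - g)) \<le> 0"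
  proof -
    define Y where "Y = (\<Sum>k<K. m k * x k)"
    have "Y \<le> (\<Sum>k<K. m k)" unfolding Y_def using m x by (intro sum_mono) (simp add: mult_left_le)
    then have Y1: "Y \<le> 1" using m by simp
    have "X = g / real K * (\<Sum>k<K. x k) + (1 - g) * Y"
      unfolding X_def Y_def sum_distrib_left sum.distrib[symmetric]
      by (intro sum.cong refl) (simp add: p distrib_right mult.assoc)
    moreover have "0 \<le> g / real K * (\<Sum>k<K. x k)"
      using g x by (intro mult_nonneg_nonneg sum_nonneg) auto
    ultimately have "Y - X - g \<le> g * (Y - 1)" by (simp add: algebra_simps)
    also have "\<dots> \<le> 0" using g Y1 by (simp add: mult_nonneg_nonpos)
    finally have "Y - X - g \<le> 0" .
    have "(\<Sum>k<K. max 0 (e k - \<theta>) * (x k - X - g)) = (\<Sum>k<K. S * (m k * x k) - S * (X + g) * m k)"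
      by (intro sum.cong refl) (simp add: S(2) algebra_simps)
    also have "\<dots> = S * Y - S * (X + g) * 1"
      by (simp only: sum_subtractf Y_def m(2) flip: sum_distrib_left)
    also have "\<dots> = S * (Y - X - g)" by (simp add: algebra_simps)
    finally show ?thesis using S(1) \<open>Y - X - g \<le> 0\<close> by (simp add: mult_nonneg_nonpos)
  qed
  have "(\<Sum>a<K. p a * (\<Sum>k<K. (max 0 (e k + \<delta> a k - \<theta>))\<^sup>2 + (d k + \<zeta> a k)\<^sup>2))
      \<le> (\<Sum>a<K. p a * (\<Sum>k<K. (max 0 (e k - \<theta>))\<^sup>2 + (d k)\<^sup>2 + 2 * max 0 (e k - \<theta>) * \<delta> a k
            + (\<delta> a k)\<^sup>2 + 2 * d k * \<zeta> a k + (\<zeta> a k)\<^sup>2))"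
  proof (intro sum_mono mult_left_mono)
    fix a k
    show "(max 0 (e k + \<delta> a k - \<theta>))\<^sup>2 + (d k + \<zeta> a k)\<^sup>2
        \<le> (max 0 (e k - \<theta>))\<^sup>2 + (d k)\<^sup>2 + 2 * max 0 (e k - \<theta>) * \<delta> a k
            + (\<delta> a k)\<^sup>2 + 2 * d k * \<zeta> a k + (\<zeta> a k)\<^sup>2"
      using pos_part_sq_step[of "e k - \<theta>" "\<delta> a k"]
      by (simp add: power2_sum algebra_simps)
  qed (use ppos in \<open>auto intro: less_imp_le\<close>)
  also have "\<dots> = (\<Sum>k<K. \<Sum>a<K. p a * ((max 0 (e k - \<theta>))\<^sup>2 + (d k)\<^sup>2)
      + 2 * max 0 (e k - \<theta>) * (p a * \<delta> a k) + p a * (\<delta> a k)\<^sup>2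
      + 2 * d k * (p a * \<zeta> a k) + p a * (\<zeta> a k)\<^sup>2)"
    unfolding sum_distrib_left by (subst sum.swap) (simp add: algebra_simps)
  also have "\<dots> = (\<Sum>k<K. ((max 0 (e k - \<theta>))\<^sup>2 + (d k)\<^sup>2)
      + 2 * max 0 (e k - \<theta>) * (x k - X - g) + (\<Sum>a<K. p a * (\<delta> a k)\<^sup>2)
      + (\<Sum>a<K. p a * (\<zeta> a k)\<^sup>2))"
    by (intro sum.cong refl)
      (simp add: sum.distrib d1 z1 sp flip: sum_distrib_left sum_distrib_right)
  also have "\<dots> \<le> (\<Sum>k<K. ((max 0 (e k - \<theta>))\<^sup>2 + (d k)\<^sup>2)
      + 2 * (max 0 (e k - \<theta>) * (x k - X - g)) + 10 * real K / g + real K / g)"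
    by (intro sum_mono add_mono d2 z2) auto
  also have "\<dots> = (\<Sum>k<K. (max 0 (e k - \<theta>))\<^sup>2 + (d k)\<^sup>2)
      + 2 * (\<Sum>k<K. max 0 (e k - \<theta>) * (x k - X - g)) + 11 * (real K)\<^sup>2 / g"
  proof -
    have "real K * (10 * real K / g) + real K * (real K / g) = 11 * (real K)\<^sup>2 / g"
      using g by (simp add: power2_eq_square field_simps)
    then show ?thesis
      by (simp only: sum.distrib sum_constant card_lessThan flip: sum_distrib_left)
  qed
  also have "\<dots> \<le> (\<Sum>k<K. (max 0 (e k - \<theta>))\<^sup>2 + (d k)\<^sup>2) + 11 * (real K)\<^sup>2 / g"
    using drift by simp
  finally show ?thesis by (simp add: \<delta>_def \<zeta>_def)
qed

section \<open>Hannan consistency\<close>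

text \<open>The rewards are determined by the arms, so the list of arms is a complete state. Unlike
  a history with real rewards it lives in a countable type, as the measurability of
  \<open>chain\<close> requires.\<close>

primrec play :: "adversary \<Rightarrow> nat list \<Rightarrow> hist" where
  "play adv [] = []"
| "play adv (a # as) = (a, adv (rev as) a) # play adv as"

definition play_step :: "nat \<Rightarrow> adversary \<Rightarrow> nat list \<Rightarrow> real \<Rightarrow> nat list" where
  "play_step K adv as u = alg K (rev (play adv as)) u # as"

lemma length_play [simp]: "length (play adv as) = length as"
  by (induction as) auto

lemma map_fst_play [simp]: "map fst (play adv as) = as"
  by (induction as) auto

lemma bandit_hist_eq:
  "bandit_hist alg K adv \<omega> t = rev (play adv (chain (play_step K adv) [] \<omega> t))"
  by (induction t) (simp_all add: Let_def play_step_def rev_map[symmetric])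

lemma length_chain_play: "length (chain (play_step K adv) s \<omega> t) = length s + t"
  by (induction t) (simp_all add: play_step_def)

text \<open>True minus estimated gain. Within a block this is a martingale, since the control
  variate keeps the estimate unbiased.\<close>

primrec est_err :: "nat \<Rightarrow> adversary \<Rightarrow> nat list \<Rightarrow> nat \<Rightarrow> real" where
  "est_err K adv [] = (\<lambda>_. 0)"
| "est_err K adv (a # as) = (\<lambda>k. restart (length as) (est_err K adv as) k
     + (adv (rev as) k - gain_est K (play adv as) (cur K (play adv as)) (a, adv (rev as) a) k))"

primrec block_regret :: "adversary \<Rightarrow> nat list \<Rightarrow> nat \<Rightarrow> real" where
  "block_regret adv [] = (\<lambda>_. 0)"
| "block_regret adv (a # as) =
     (\<lambda>k. restart (length as) (block_regret adv as) k + (adv (rev as) k - adv (rev as) a))"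

definition pot :: "nat \<Rightarrow> adversary \<Rightarrow> nat \<Rightarrow> nat list \<Rightarrow> real" where
  "pot K adv n as =
     (\<Sum>k<K. (max 0 (est K (play adv as) k - thr n))\<^sup>2 + (est_err K adv as k)\<^sup>2)"

lemma pot_nonneg: "0 \<le> pot K adv n as"
  unfolding pot_def by (intro sum_nonneg) auto

lemma sum_arm_prob_pot_le:
  assumes K: "0 < K" and adv: "valid_adv adv" and n: "blk (length as) = n"
  shows "(\<Sum>a<K. arm_prob K (play adv as) (cur K (play adv as)) a * pot K adv n (a # as))
    \<le> (if length as = n ^ 20 then 0 else pot K adv n as) + 11 * (real K)\<^sup>2 / rate K n"
proof -
  let ?r = "play adv as" let ?e = "cur K ?r" let ?d = "restart (length as) (est_err K adv as)"
  let ?S = "if \<forall>j<K. ?e j \<le> thr n then 0 else (\<Sum>j<K. max 0 (?e j - thr n))"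
  have S: "0 \<le> ?S" "max 0 (?e k - thr n) = ?S * mix K ?r ?e k" if "k < K" for k
  proof -
    show "0 \<le> ?S" by (auto intro!: sum_nonneg)
    show "max 0 (?e k - thr n) = ?S * mix K ?r ?e k"
    proof (cases "\<forall>j<K. ?e j \<le> thr n")
      case False
      then obtain j where j: "j < K" "thr n < ?e j" by (auto simp: not_le)
      have "0 < max 0 (?e j - thr n)" using j by simp
      also have "\<dots> \<le> (\<Sum>j<K. max 0 (?e j - thr n))" using j by (intro member_le_sum) auto
      finally show ?thesis using False unfolding mix_def Let_def length_play n if_not_P[OF False[unfolded length_play]] by simp
    qed (use that in auto)
  qed
  have bnd: "0 \<le> adv h k" "adv h k \<le> 1" for h k using adv by (auto simp: valid_adv_def)
  have "(\<Sum>a<K. arm_prob K ?r ?e a * pot K adv n (a # as))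
      = (\<Sum>a<K. arm_prob K ?r ?e a * (\<Sum>k<K.
             (max 0 (?e k + (pred K ?r k + of_bool (a = k) * (adv (rev as) a - pred K ?r k)
                 / arm_prob K ?r ?e k - adv (rev as) a - rate K n) - thr n))\<^sup>2
           + (?d k + (adv (rev as) k - (pred K ?r k + of_bool (a = k) * (adv (rev as) a - pred K ?r k)
                 / arm_prob K ?r ?e k)))\<^sup>2))"
    by (simp add: pot_def gain_est_def n)
  also have "\<dots> \<le> (\<Sum>k<K. (max 0 (?e k - thr n))\<^sup>2 + (?d k)\<^sup>2) + 11 * (real K)\<^sup>2 / rate K n"
    using K rate_pos[of K n] rate_le_half[of K n] mix_nonneg sum_mix[OF K] S
    by (intro regret_matching_step[where m = "mix K ?r ?e" and S = ?S])
      (auto simp: arm_prob_def Let_def n bnd pred_bounds)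
  also have "(\<Sum>k<K. (max 0 (?e k - thr n))\<^sup>2 + (?d k)\<^sup>2)
      = (if length as = n ^ 20 then 0 else pot K adv n as)"
    using n thr_pos[of n] by (auto simp: restart_def pot_def max_def)
  finally show ?thesis .
qed

lemma nn_integral_pot_step_le:
  assumes K: "0 < K" and adv: "valid_adv adv" and n: "blk (length as) = n"
  shows "(\<integral>\<^sup>+u. ennreal (pot K adv n (play_step K adv as u)) \<partial>unif)
    \<le> ennreal (if length as = n ^ 20 then 0 else pot K adv n as) + ennreal (11 * (real K)\<^sup>2 / rate K n)"
proof -
  let ?r = "play adv as"
  let ?F = "\<lambda>j. ennreal (pot K adv n (j mod K # as))"
  have w: "(\<Sum>j<K + K. wts K ?r j * G j)
      = (\<Sum>a<K. arm_prob K ?r (cur K ?r) a * G a)" if "\<And>a. G (K + a) = G a" for G :: "nat \<Rightarrow> real"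
    unfolding sum_lessThan_add sum.distrib[symmetric]
    by (intro sum.cong) (auto simp: wts_def arm_prob_def Let_def that distrib_right)
  have "(\<integral>\<^sup>+u. ennreal (pot K adv n (play_step K adv as u)) \<partial>unif)
      = (\<integral>\<^sup>+u. ?F (sample (wts K ?r) u) \<partial>unif)"
    by (simp add: play_step_def alg_def)
  also have "\<dots> \<le> (\<Sum>j<K + K. ennreal (wts K ?r j) * ?F j)"
    using w[of "\<lambda>_. 1"] sum_arm_prob[OF K]
    by (intro nn_integral_sample_le wts_nonneg) simp
  also have "\<dots> = ennreal (\<Sum>j<K + K. wts K ?r j * pot K adv n (j mod K # as))"
    by (simp add: ennreal_mult[symmetric] wts_nonneg pot_nonneg)
  also have "(\<Sum>j<K + K. wts K ?r j * pot K adv n (j mod K # as))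
      = (\<Sum>a<K. arm_prob K ?r (cur K ?r) a * pot K adv n (a mod K # as))"
    by (rule w) simp
  also have "\<dots> = (\<Sum>a<K. arm_prob K ?r (cur K ?r) a * pot K adv n (a # as))"
    by (intro sum.cong) auto
  also have "\<dots> \<le> (if length as = n ^ 20 then 0 else pot K adv n as) + 11 * (real K)\<^sup>2 / rate K n"
    by (rule sum_arm_prob_pot_le[OF assms])
  also have "ennreal \<dots> = ennreal (if length as = n ^ 20 then 0 else pot K adv n as)
      + ennreal (11 * (real K)\<^sup>2 / rate K n)"
    using pot_nonneg rate_pos[of K n] by (intro ennreal_plus) auto
  finally show ?thesis by (simp add: ennreal_leI)
qed

lemma measurable_play_step: "play_step K adv as \<in> borel \<rightarrow>\<^sub>M count_space UNIV"
proof -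
  have "alg K h \<in> borel \<rightarrow>\<^sub>M count_space UNIV" for h
    unfolding alg_def by (rule measurable_compose[OF measurable_sample]) simp
  then show ?thesis
    unfolding play_step_def by (rule measurable_compose) simp
qed

lemma nn_integral_pot_le:
  assumes K: "0 < K" and adv: "valid_adv adv"
  shows "(\<integral>\<^sup>+\<omega>. ennreal (pot K adv n (chain (play_step K adv) [] \<omega> (Suc n ^ 20))) \<partial>unif_seq)
    \<le> ennreal (11 * (real K)\<^sup>2 / rate K n * block_len n)"
proof -
  let ?C = "11 * (real K)\<^sup>2 / rate K n"
  \<comment> \<open>The window isolates block n: before it nothing accumulates, and every step
    inside adds at most \<open>?C\<close>. Its right end is included since the potential is read
    when the block is complete and not yet restarted. Tying the length to t makes the step bound
    hold for all states.\<close>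
  define W where "W t as = (if length as = t \<and> n ^ 20 < t \<and> t \<le> Suc n ^ 20
      then ennreal (pot K adv n as) else 0)" for t as
  define c where "c t = (if n ^ 20 \<le> t \<and> t < Suc n ^ 20 then ennreal ?C else 0)" for t
  have C: "0 \<le> ?C" using rate_pos[of K n] by simp
  have "n ^ 20 < Suc n ^ 20" by (rule power_strict_mono) auto
  have step: "(\<integral>\<^sup>+u. W (Suc t) (play_step K adv as u) \<partial>unif) \<le> W t as + c t" for t as
  proof (cases "length as = t \<and> n ^ 20 \<le> t \<and> t < Suc n ^ 20")
    case True
    then have "blk (length as) = n" by (intro blk_eqI) auto
    from nn_integral_pot_step_le[OF K adv this] True show ?thesis
      by (auto simp: W_def c_def play_step_def less_Suc_eq_le Suc_le_eq)
  next
    case False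
    then have "W (Suc t) (play_step K adv as u) = 0" for u
      by (auto simp: W_def play_step_def)
    then show ?thesis by simp
  qed
  have "(\<integral>\<^sup>+\<omega>. W (0 + Suc n ^ 20) (chain (play_step K adv) [] \<omega> (Suc n ^ 20)) \<partial>unif_seq)
      \<le> W 0 [] + (\<Sum>i<Suc n ^ 20. c (0 + i))"
    by (rule nn_integral_chain_le) (rule measurable_play_step step)+
  also have "W 0 [] = 0" by (simp add: W_def)
  also have "(\<Sum>i<Suc n ^ 20. c (0 + i)) = (\<Sum>i\<in>{n ^ 20..<Suc n ^ 20}. ennreal ?C)"
    unfolding c_def by (intro sum.mono_neutral_cong_right) auto
  also have "\<dots> = of_nat (Suc n ^ 20 - n ^ 20) * ennreal ?C" by simp
  also have "\<dots> = ennreal (real (Suc n ^ 20 - n ^ 20) * ?C)"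
    using C by (subst ennreal_mult) (auto simp: ennreal_of_nat_eq_real_of_nat)
  also have "real (Suc n ^ 20 - n ^ 20) = block_len n"
    using \<open>n ^ 20 < Suc n ^ 20\<close> by (simp add: block_len_def of_nat_diff del: of_nat_Suc)
  finally show ?thesis
    using \<open>n ^ 20 < Suc n ^ 20\<close> by (simp add: W_def length_chain_play mult.commute)
qed

lemma AE_tendsto_0_quadratic:
  fixes X :: "nat \<Rightarrow> 'a \<Rightarrow> real"
  assumes "\<And>n. X n \<in> borel_measurable M" "\<And>n x. 0 \<le> X n x"
    and "\<And>n. (\<integral>\<^sup>+x. ennreal (X n x) \<partial>M) \<le> ennreal (C / real (Suc n) ^ 2)" and "0 \<le> C"
  shows "AE x in M. (\<lambda>n. X n x) \<longlonglongrightarrow> 0"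
proof (rule AE_tendsto_0_of_summable)
  have "summable (\<lambda>n. C * (1 / real (Suc n) ^ 2))"
    using summable_Suc_iff[of "\<lambda>n. inverse (real n ^ 2)"] inverse_power_summable[of 2, where 'a = real]
    by (intro summable_mult) (simp add: inverse_eq_divide)
  then show "summable (\<lambda>n. C / real (Suc n) ^ 2)" by simp
qed (use assms in auto)

lemma real_add2_power_le: "real (n + 2) ^ m \<le> 2 ^ m * real (Suc n) ^ m"
  unfolding power_mult_distrib[symmetric] by (rule power_mono) auto

lemma power_quotient_le:
  assumes "i + 2 \<le> j"
  shows "real (Suc n) ^ i / real (Suc n) ^ j \<le> 1 / real (Suc n) ^ 2"
proof -
  have "real (Suc n) ^ i * real (Suc n) ^ 2 \<le> real (Suc n) ^ j"
    unfolding power_add[symmetric] using assms by (intro power_increasing) auto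
  then show ?thesis by (simp add: divide_le_eq le_divide_eq del: of_nat_Suc)
qed

text \<open>The budget of Hannan consistency: order n^10 from 1 / rate times n^19 from the block
  length, against n^36 from the squared threshold.\<close>

lemma AE_pot_tendsto_0:
  assumes K: "0 < K" and adv: "valid_adv adv"
  shows "AE \<omega> in unif_seq.
    (\<lambda>n. pot K adv n (chain (play_step K adv) [] \<omega> (Suc n ^ 20)) / (thr n)\<^sup>2) \<longlonglongrightarrow> 0"
proof (rule AE_tendsto_0_quadratic)
  fix n
  let ?c = "\<lambda>\<omega>. chain (play_step K adv) [] \<omega> (Suc n ^ 20)"
  have m: "(\<lambda>\<omega>. pot K adv n (?c \<omega>)) \<in> borel_measurable unif_seq"
    by (rule measurable_compose[OF measurable_chain[OF measurable_play_step]]) simp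
  then show "(\<lambda>\<omega>. pot K adv n (?c \<omega>) / (thr n)\<^sup>2) \<in> borel_measurable unif_seq"
    by measurable
  have "(\<integral>\<^sup>+\<omega>. ennreal (pot K adv n (?c \<omega>) / (thr n)\<^sup>2) \<partial>unif_seq)
      = (\<integral>\<^sup>+\<omega>. ennreal (1 / (thr n)\<^sup>2) * ennreal (pot K adv n (?c \<omega>)) \<partial>unif_seq)"
    by (simp add: ennreal_mult[symmetric] pot_nonneg)
  also have "\<dots> = ennreal (1 / (thr n)\<^sup>2) * (\<integral>\<^sup>+\<omega>. ennreal (pot K adv n (?c \<omega>)) \<partial>unif_seq)"
    using m by (intro nn_integral_cmult) auto
  also have "\<dots> \<le> ennreal (1 / (thr n)\<^sup>2) * ennreal (11 * (real K)\<^sup>2 / rate K n * block_len n)"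
    by (intro mult_left_mono nn_integral_pot_le K adv) auto
  also have "\<dots> = ennreal (1 / (thr n)\<^sup>2 * (11 * (real K)\<^sup>2 / rate K n * block_len n))"
    by (rule ennreal_mult'[symmetric]) simp
  also have "\<dots> \<le> ennreal ((11 * (real K)\<^sup>2 * 2 ^ 10 * 20) / real (Suc n) ^ 2)"
  proof (rule ennreal_leI)
    have "1 / rate K n \<le> real (n + 2) ^ 10"
      using rate_ge[of n K] rate_pos[of K n] by (simp add: field_simps)
    also have "\<dots> \<le> 2 ^ 10 * real (Suc n) ^ 10" by (rule real_add2_power_le)
    finally have "1 / rate K n * block_len n \<le> (2 ^ 10 * real (Suc n) ^ 10) * (20 * real (Suc n) ^ 19)"
      using block_len_le[of n] block_len_ge[of n]
      by (intro mult_mono) (auto intro: order_trans[rotated])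
    then have "1 / (thr n)\<^sup>2 * (11 * (real K)\<^sup>2 * (1 / rate K n * block_len n))
        \<le> 1 / (thr n)\<^sup>2 * (11 * (real K)\<^sup>2 * ((2 ^ 10 * real (Suc n) ^ 10) * (20 * real (Suc n) ^ 19)))"
      by (intro mult_left_mono) auto
    also have "\<dots> = (11 * (real K)\<^sup>2 * 2 ^ 10 * 20) * (real (Suc n) ^ (10 + 19) / real (Suc n) ^ 36)"
      unfolding thr_def power_mult[symmetric] power_add by simp
    also have "\<dots> \<le> (11 * (real K)\<^sup>2 * 2 ^ 10 * 20) * (1 / real (Suc n) ^ 2)"
      by (intro mult_left_mono power_quotient_le) auto
    finally show "1 / (thr n)\<^sup>2 * (11 * (real K)\<^sup>2 / rate K n * block_len n)
        \<le> (11 * (real K)\<^sup>2 * 2 ^ 10 * 20) / real (Suc n) ^ 2"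
      by simp
  qed
  finally show "(\<integral>\<^sup>+\<omega>. ennreal (pot K adv n (?c \<omega>) / (thr n)\<^sup>2) \<partial>unif_seq)
      \<le> ennreal ((11 * (real K)\<^sup>2 * 2 ^ 10 * 20) / real (Suc n) ^ 2)" .
qed (auto simp: pot_nonneg)

text \<open>Each regret increment splits into the increment of the estimate, its error, and the rate
  that the estimate subtracts. The index \<open>length as - 1\<close> is the time of the last
  decision, so at the end of a block it still names the finished block.\<close>

lemma block_regret_decomp:
  assumes "as \<noteq> []"
  shows "block_regret adv as k = est K (play adv as) k + est_err K adv as k
    + rate K (blk (length as - 1)) * real (length as - blk (length as - 1) ^ 20)"
  using assms
proof (induction as)
  case (Cons a as)
  let ?t = "length as"
  show ?case
  proof (cases "blk ?t ^ 20 = ?t")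
    case True
    then show ?thesis by (simp add: restart_def)
  next
    case False
    then have lt: "blk ?t ^ 20 < ?t" using blk_bounds(1)[of ?t] by linarith
    then have "blk (?t - 1) = blk ?t"
      using blk_bounds(2)[of ?t] by (intro blk_eqI) auto
    moreover have "as \<noteq> []" using lt by auto
    moreover have "real (Suc ?t - blk ?t ^ 20) = real (?t - blk ?t ^ 20) + 1"
      using lt by (simp add: Suc_diff_le)
    ultimately show ?thesis using Cons.IH False by (simp add: restart_def algebra_simps)
  qed
qed simp

lemma block_regret_chain:
  fixes \<omega> K adv
  defines "c \<equiv> chain (play_step K adv) [] \<omega>"
  defines "R \<equiv> \<lambda>t k. \<Sum>s<t. adv (rev (c s)) k - adv (rev (c s)) (hd (c (Suc s)))"
  shows "block_regret adv (c (Suc t)) k = R (Suc t) k - R (blk t ^ 20) k"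
proof (induction t)
  case 0
  have "blk 0 = 0" by (rule blk_eqI) auto
  then show ?case by (simp add: c_def R_def play_step_def restart_def)
next
  case (Suc t)
  have len: "length (c (Suc t)) = Suc t" unfolding c_def by (simp add: length_chain_play del: chain.simps)
  have e: "block_regret adv (c (Suc (Suc t))) k
      = restart (Suc t) (block_regret adv (c (Suc t))) k + (R (Suc (Suc t)) k - R (Suc t) k)"
    using len by (simp add: c_def R_def play_step_def)
  show ?case
  proof (cases "blk (Suc t) ^ 20 = Suc t")
    case True
    with e show ?thesis by (simp add: restart_def)
  next
    case False
    then have "blk (Suc t) ^ 20 \<le> t" using blk_bounds(1)[of "Suc t"] by linarith
    then have "blk t = blk (Suc t)"
      using blk_bounds(2)[of "Suc t"] by (intro blk_eqI) auto
    with e Suc False show ?thesis by (simp add: restart_def)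
  qed
qed

text \<open>Late complete blocks contribute a small multiple of their length. The current incomplete
  block is bounded by its own length, which is of lower order than the time at which it
  starts.\<close>

lemma sublinear_of_blocks:
  fixes R :: "nat \<Rightarrow> real"
  assumes R0: "R 0 = 0" and step: "\<And>t. R (Suc t) \<le> R t + 1"
    and blk: "eventually (\<lambda>n. R (Suc n ^ 20) - R (n ^ 20) \<le> 4 * block_len n / real (Suc n)) sequentially"
    and e: "0 < e"
  shows "eventually (\<lambda>t. R t \<le> e * real t) sequentially"
proof -
  obtain N where N: "\<And>n. N \<le> n \<Longrightarrow> R (Suc n ^ 20) - R (n ^ 20) \<le> 4 * block_len n / real (Suc n)"
    using blk by (auto simp: eventually_sequentially)
  \<comment> \<open>One third each for the early blocks, the complete late blocks and the current
    block.\<close>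
  define d where "d = e / 3"
  have d: "0 < d" using e by (simp add: d_def)
  \<comment> \<open>From here on 20 (2 n)^19 \<le> d n^20, so a block is short compared with its
    start; also 4 / (n + 1) \<le> d.\<close>
  obtain M0 where M0: "20 * 2 ^ 19 / d \<le> real M0" using real_arch_simple by blast
  define M where "M = Suc (max N M0)"
  have M: "N \<le> M" "20 * 2 ^ 19 / d \<le> real M" "0 < M" using M0 by (auto simp: M_def)
  have add: "R (t + m) \<le> R t + real m" for t m
  proof (induction m)
    case (Suc m)
    then show ?case using step[of "t + m"] by simp
  qed simp
  have blk': "R (Suc n ^ 20) \<le> R (n ^ 20) + d * block_len n" if n: "M \<le> n" for n
  proof -
    have "4 \<le> d * real (Suc n)"
    proof -
      have "20 * 2 ^ 19 \<le> d * real M" using M(2) d by (simp add: field_simps)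
      also have "\<dots> \<le> d * real (Suc n)" using n d by (intro mult_left_mono) auto
      finally show ?thesis by simp
    qed
    then have "4 / real (Suc n) \<le> d" by (simp add: divide_le_eq)
    then have "4 / real (Suc n) * block_len n \<le> d * block_len n"
      using block_len_ge[of n] by (intro mult_right_mono) (auto intro: order_trans[rotated])
    then show ?thesis using N[of n] n M by simp
  qed
  have pow: "R (n ^ 20) \<le> real (M ^ 20) + d * real (n ^ 20)" if "M \<le> n" for n
    using that
  proof (induction n rule: dec_induct)
    case base
    have "0 \<le> d * real (M ^ 20)" using d by simp
    then show ?case using add[of 0 "M ^ 20"] R0 by simp
  next
    case (step n)
    have "d * block_len n = d * real (Suc n ^ 20) - d * real (n ^ 20)"
      by (simp add: block_len_def algebra_simps del: of_nat_Suc)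
    then show ?case using blk'[of n] step by simp
  qed
  obtain T where T: "real (M ^ 20) / d \<le> real T" using real_arch_simple by blast
  show ?thesis
    unfolding eventually_sequentially
  proof (intro exI allI impI)
    fix t assume t: "max T (M ^ 20) \<le> t"
    let ?n = "blk t"
    have n: "M \<le> ?n" using t by (intro blk_ge) simp
    then have n0: "0 < ?n" using M by simp
    have b: "?n ^ 20 \<le> t" "t < Suc ?n ^ 20" by (rule blk_bounds)+
    have "R t \<le> R (?n ^ 20) + real (t - ?n ^ 20)" using add[of "?n ^ 20" "t - ?n ^ 20"] b by simp
    also have "real (t - ?n ^ 20) \<le> block_len ?n"
    proof -
      have "real (t - ?n ^ 20) = real t - real ?n ^ 20" using b(1) by (simp add: of_nat_diff)
      moreover have "real t \<le> real (Suc ?n) ^ 20"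
        using b(2) by (metis less_imp_le of_nat_le_iff of_nat_power)
      ultimately show ?thesis unfolding block_len_def by linarith
    qed
    also have "block_len ?n \<le> 20 * real (Suc ?n) ^ 19" by (rule block_len_le)
    also have "\<dots> \<le> 20 * (2 * real ?n) ^ 19" using n0 by (intro mult_left_mono power_mono) auto
    also have "\<dots> \<le> d * real ?n * real ?n ^ 19"
    proof -
      have "20 * 2 ^ 19 \<le> d * real M" using M(2) d by (simp add: field_simps)
      also have "\<dots> \<le> d * real ?n" using n d by (intro mult_left_mono) auto
      finally have "20 * 2 ^ 19 * real ?n ^ 19 \<le> d * real ?n * real ?n ^ 19"
        by (intro mult_right_mono) auto
      then show ?thesis by (simp add: power_mult_distrib)
    qed
    also have "\<dots> = d * real (?n ^ 20)"
      using power_Suc[of "real ?n" 19] by simp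
    also have "\<dots> \<le> d * real t" using b d by (intro mult_left_mono) auto
    also have "R (?n ^ 20) \<le> real (M ^ 20) + d * real (?n ^ 20)" by (rule pow[OF n])
    also have "real (M ^ 20) \<le> d * real t"
    proof -
      have "real (M ^ 20) \<le> d * real T" using T d by (simp add: field_simps)
      also have "\<dots> \<le> d * real t" using t d by (intro mult_left_mono) auto
      finally show ?thesis .
    qed
    also have "d * real (?n ^ 20) \<le> d * real t" using b d by (intro mult_left_mono) auto
    finally show "R t \<le> e * real t" by (simp add: d_def)
  qed
qed

lemma regret_eq_Max:
  assumes "0 < K"
  shows "regret alg K adv \<omega> t = Max ((\<lambda>k. \<Sum>s<t.
      adv (rev (chain (play_step K adv) [] \<omega> s)) k
        - adv (rev (chain (play_step K adv) [] \<omega> s)) (hd (chain (play_step K adv) [] \<omega> (Suc s)))) ` {..<K})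
     / real t"
proof -
  let ?c = "chain (play_step K adv) [] \<omega>"
  have r: "reward_at alg K adv \<omega> s k = adv (rev (?c s)) k" for s k
    by (simp add: reward_at_def bandit_hist_eq rev_map[symmetric])
  have a: "arm_at alg K adv \<omega> s = hd (?c (Suc s))" for s
    by (simp add: arm_at_def bandit_hist_eq play_step_def del: bandit_hist.simps)
  let ?S = "\<Sum>s<t. adv (rev (?c s)) (hd (?c (Suc s)))"
  have "Max ((\<lambda>k. \<Sum>s<t. adv (rev (?c s)) k) ` {..<K}) - ?S
      = Max ((\<lambda>x. x - ?S) ` (\<lambda>k. \<Sum>s<t. adv (rev (?c s)) k) ` {..<K})"
    using assms by (intro mono_Max_commute) (auto simp: mono_def)
  then show ?thesis unfolding regret_def r a
    by (simp add: image_image sum_subtractf del: chain.simps)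
qed

theorem hannan_consistent_alg: "hannan_consistent 0 alg"
  unfolding hannan_consistent_def bandit_space_def
proof (intro allI impI)
  fix K :: nat and adv assume K: "0 < K" and adv: "valid_adv adv"
  show "AE \<omega> in unif_seq. limsup (\<lambda>t. ereal (regret alg K adv \<omega> t)) \<le> ereal 0"
    using AE_pot_tendsto_0[OF K adv]
  proof eventually_elim
    case (elim \<omega>)
    define c where "c = chain (play_step K adv) [] \<omega>"
    define R where "R t k = (\<Sum>s<t. adv (rev (c s)) k - adv (rev (c s)) (hd (c (Suc s))))" for t k
    have bnd: "0 \<le> adv h k" "adv h k \<le> 1" for h k using adv by (auto simp: valid_adv_def)
    have len: "length (c t) = t" for t unfolding c_def by (simp add: length_chain_play)
    \<comment> \<open>The 4 collects: at most 2 \<open>thr n\<close> from the estimate,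
      \<open>thr n\<close> from its error, each \<open>thr n\<close> being at most
      \<open>block_len n / real (Suc n)\<close>, and once more this quantity for
      exploration.\<close>
    have ev: "eventually (\<lambda>n. R (Suc n ^ 20) k - R (n ^ 20) k \<le> 4 * block_len n / real (Suc n)) sequentially"
      if k: "k < K" for k
    proof -
      have "eventually (\<lambda>n. pot K adv n (c (Suc n ^ 20)) / (thr n)\<^sup>2 < 1) sequentially"
        using elim unfolding c_def by (intro order_tendstoD) auto
      then show ?thesis
      proof eventually_elim
        case (elim n)
        let ?as = "c (Suc n ^ 20)"
        define T where "T = Suc n ^ 20 - 1"
        have "0 < Suc n ^ 20" by simp
        then have T: "Suc n ^ 20 = Suc T" by (simp add: T_def)
        have "n ^ 20 < Suc n ^ 20" by (rule power_strict_mono) auto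
        then have b: "blk T = n" by (intro blk_eqI) (auto simp: T)
        have "R (Suc n ^ 20) k - R (n ^ 20) k = block_regret adv ?as k"
          using block_regret_chain[of adv K \<omega> T k] unfolding T R_def c_def b by (rule sym)
        also have "\<dots> = est K (play adv ?as) k + est_err K adv ?as k
            + rate K n * real (Suc n ^ 20 - n ^ 20)"
        proof -
          have "?as \<noteq> []" using len[of "Suc n ^ 20"] by fastforce
          from block_regret_decomp[OF this, of adv k K] show ?thesis
            unfolding len T diff_Suc_1 b .
        qed
        also have "real (Suc n ^ 20 - n ^ 20) = block_len n"
          using \<open>n ^ 20 < Suc n ^ 20\<close> by (simp add: block_len_def of_nat_diff del: of_nat_Suc)
        finally have eq: "R (Suc n ^ 20) k - R (n ^ 20) k
            = est K (play adv ?as) k + est_err K adv ?as k + rate K n * block_len n" .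
        have "(max 0 (est K (play adv ?as) k - thr n))\<^sup>2 + (est_err K adv ?as k)\<^sup>2 \<le> pot K adv n ?as"
          unfolding pot_def using k
          by (intro member_le_sum[of k "{..<K}" "\<lambda>k. (max 0 (est K (play adv ?as) k - thr n))\<^sup>2
              + (est_err K adv ?as k)\<^sup>2"]) auto
        also have "\<dots> \<le> (thr n)\<^sup>2" using elim thr_pos[of n] by (simp add: divide_less_eq)
        finally have le: "(max 0 (est K (play adv ?as) k - thr n))\<^sup>2 + (est_err K adv ?as k)\<^sup>2 \<le> (thr n)\<^sup>2" .
        have "max 0 (est K (play adv ?as) k - thr n) \<le> thr n"
          by (rule power2_le_imp_le)
            (use thr_pos[of n] le zero_le_power2[of "est_err K adv ?as k"] in linarith)+
        moreover have "est_err K adv ?as k \<le> thr n"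
          by (rule power2_le_imp_le)
            (use thr_pos[of n] le zero_le_power2[of "max 0 (est K (play adv ?as) k - thr n)"] in linarith)+
        moreover have "thr n \<le> block_len n / real (Suc n)"
        proof -
          have "thr n * real (Suc n) = real (Suc n) ^ 19"
            using power_Suc2[of "real (Suc n)" 18] by (simp add: thr_def del: of_nat_Suc)
          then show ?thesis using block_len_ge[of n] by (simp add: le_divide_eq del: of_nat_Suc)
        qed
        moreover have "rate K n * block_len n \<le> block_len n / real (Suc n)"
        proof -
          have "rate K n \<le> 1 / real (Suc n)"
            by (rule order_trans[OF rate_le]) (simp add: divide_left_mono)
          moreover have "0 \<le> block_len n"
            using block_len_ge[of n] by (rule order_trans[rotated]) simp
          ultimately have "rate K n * block_len n \<le> 1 / real (Suc n) * block_len n"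
            by (rule mult_right_mono)
          then show ?thesis by simp
        qed
        ultimately show ?case unfolding eq by linarith
      qed
    qed
    have "eventually (\<lambda>t. ereal (regret alg K adv \<omega> t) \<le> 0 + ereal e) sequentially" if e: "0 < e" for e
    proof -
      have "eventually (\<lambda>t. R t k \<le> e * real t) sequentially" if k: "k < K" for k
      proof (rule sublinear_of_blocks[OF _ _ ev[OF k] e])
        fix t
        have "adv (rev (c t)) k - adv (rev (c t)) (hd (c (Suc t))) \<le> 1"
          using bnd(2)[of "rev (c t)" k] bnd(1)[of "rev (c t)" "hd (c (Suc t))"] by linarith
        then show "R (Suc t) k \<le> R t k + 1" unfolding R_def sum.lessThan_Suc by linarith
      qed (simp add: R_def)
      then have "eventually (\<lambda>t. \<forall>k\<in>{..<K}. R t k \<le> e * real t) sequentially"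
        by (intro eventually_ball_finite) auto
      then show ?thesis using eventually_gt_at_top[of 0]
      proof eventually_elim
        case (elim t)
        then have "Max ((\<lambda>k. R t k) ` {..<K}) \<le> e * real t"
          using K by (subst Max_le_iff) auto
        then show ?case using elim(2) unfolding regret_eq_Max[OF K] R_def c_def
          by (simp add: divide_le_eq del: chain.simps)
      qed
    qed
    then have lim: "limsup (\<lambda>t. ereal (regret alg K adv \<omega> t)) \<le> 0 + ereal e" if "0 < e" for e
      using that by (intro Limsup_bounded)
    show ?case
    proof (rule ereal_le_epsilon2)
      fix e :: real assume "0 < e"
      from lim[OF this] show "limsup (\<lambda>t. ereal (regret alg K adv \<omega> t)) \<le> ereal 0 + ereal e"
        by (simp add: zero_ereal_def)
    qed
  qed
qed

section \<open>Guaranteed exploration\<close>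

text \<open>The forcing interval depends on the history only through its length. Exploration can
  therefore be read off the random source alone, whatever the values returned by the search.\<close>

lemma alg_eq_explore:
  fixes h :: hist and K :: nat
  defines "g \<equiv> rate K (blk (length h))"
  assumes i: "i < K" and u: "u \<in> {real i * (g / real K)..<real (Suc i) * (g / real K)}"
  shows "alg K h u = i"
proof -
  have "sample (wts K (rev h)) u = i"
  proof (rule sample_eq[OF wts_nonneg])
    have "(\<Sum>l<j. wts K (rev h) l) = real j * (g / real K)" if "j \<le> K" for j
      using that by (simp add: wts_def g_def)
    from this[of i] this[of "Suc i"] i u
    show "(\<Sum>l<i. wts K (rev h) l) \<le> u" "u < (\<Sum>l\<le>i. wts K (rev h) l)"
      by (auto simp only: lessThan_Suc_atMost[symmetric] atLeastLessThan_iff Suc_le_eq less_imp_le)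
  qed
  then show ?thesis using i by (simp add: alg_def)
qed

lemma subgame_snoc:
  "subgame G p = Some (Node m n c) \<Longrightarrow> i < m \<Longrightarrow> j < n \<Longrightarrow> subgame G (p @ [(i, j)]) = Some (c i j)"
  by (induction G p rule: subgame.induct) (auto split: if_splits)

text \<open>The invariant that ties stored actions to the random source: the k-th stored action at a
  node is the answer of the algorithm to the first k visits and the random number with index
  k.\<close>

definition consistent_visits :: "bandit_alg \<Rightarrow> rand \<Rightarrow> game \<Rightarrow> mcts_state \<Rightarrow> bool" where
  "consistent_visits A \<omega> G H \<longleftrightarrow> (\<forall>p hs. H p = Some hs \<longrightarrow>
     (\<exists>m n c. subgame G p = Some (Node m n c) \<and> (\<forall>k<length hs.
        fst (hs ! k) = A m (map (\<lambda>(i, j, x). (i, x)) (take k hs)) (\<omega> (k, p, True)) \<and>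
        fst (snd (hs ! k)) = A n (map (\<lambda>(i, j, x). (j, 1 - x)) (take k hs)) (\<omega> (k, p, False)))))"

lemma consistent_visits_mcts_iter:
  assumes A: "valid_alg A"
  shows "consistent_visits A \<omega> G H \<Longrightarrow> subgame G p = Some g \<Longrightarrow> wf_game g \<Longrightarrow>
    consistent_visits A \<omega> G (snd (mcts_iter A roll \<omega> g p H))"
proof (induction g arbitrary: p H)
  case (Terminal u)
  then show ?case by simp
next
  case (Node m n c)
  show ?case
  proof (cases "H p")
    case None
    then show ?thesis using Node.prems by (auto simp: consistent_visits_def)
  next
    case (Some hs)
    define i where "i = A m (map (\<lambda>(i, j, x). (i, x)) hs) (\<omega> (length hs, p, True))"
    define j where "j = A n (map (\<lambda>(i, j, x). (j, 1 - x)) hs) (\<omega> (length hs, p, False))"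
    define r where "r = mcts_iter A roll \<omega> (c i j) (p @ [(i, j)]) H"
    have ij: "i < m" "j < n"
      using A Node.prems(3) by (auto simp: i_def j_def valid_alg_def)
    have r: "consistent_visits A \<omega> G (snd r)"
      unfolding r_def using Node.prems ij
      by (intro Node.IH) (auto intro: subgame_snoc)
    have eq: "snd (mcts_iter A roll \<omega> (Node m n c) p H) = (snd r)(p := Some (hs @ [(i, j, fst r)]))"
      using Some by (simp add: Let_def i_def j_def r_def)
    have hs: "fst (hs ! k) = A m (map (\<lambda>(i, j, x). (i, x)) (take k hs)) (\<omega> (k, p, True)) \<and>
        fst (snd (hs ! k)) = A n (map (\<lambda>(i, j, x). (j, 1 - x)) (take k hs)) (\<omega> (k, p, False))"
      if "k < length hs" for k
      using Node.prems(1,2) Some that unfolding consistent_visits_def by fastforce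
    show ?thesis
      unfolding eq consistent_visits_def
    proof (intro allI impI)
      fix q hs' assume q: "((snd r)(p := Some (hs @ [(i, j, fst r)]))) q = Some hs'"
      show "\<exists>m n c. subgame G q = Some (Node m n c) \<and> (\<forall>k<length hs'.
        fst (hs' ! k) = A m (map (\<lambda>(i, j, x). (i, x)) (take k hs')) (\<omega> (k, q, True)) \<and>
        fst (snd (hs' ! k)) = A n (map (\<lambda>(i, j, x). (j, 1 - x)) (take k hs')) (\<omega> (k, q, False)))"
      proof (cases "q = p")
        case True
        then have hs': "hs' = hs @ [(i, j, fst r)]" using q by simp
        have "fst (hs' ! k) = A m (map (\<lambda>(i, j, x). (i, x)) (take k hs')) (\<omega> (k, p, True)) \<and>
          fst (snd (hs' ! k)) = A n (map (\<lambda>(i, j, x). (j, 1 - x)) (take k hs')) (\<omega> (k, p, False))"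
          if "k < length hs'" for k
          using that hs[of k] unfolding hs'
          by (cases "k < length hs") (auto simp: nth_append i_def j_def less_Suc_eq)
        then show ?thesis using True Node.prems(2) by blast
      next
        case False
        then show ?thesis using q r unfolding consistent_visits_def by simp
      qed
    qed
  qed
qed

lemma consistent_visits_mcts_state:
  assumes "valid_alg A" "wf_game G"
  shows "consistent_visits A \<omega> G (mcts_state A roll G \<omega> t)"
proof (induction t)
  case 0
  show ?case by (simp add: mcts_state_def consistent_visits_def)
next
  case (Suc t)
  then show ?case
    using consistent_visits_mcts_iter[OF assms(1) Suc, of "[]" G roll] assms(2)
    by (simp add: mcts_state_def)
qed

text \<open>Comparison with the harmonic series: (\<open>blk k\<close> + 2)^20 is at most 3^20 (k +
  1), because \<open>blk k\<close> + 2 is at most three times the maximum of 1 and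
  \<open>blk k\<close>.\<close>

lemma not_summable_exploration: "0 < c \<Longrightarrow> \<not> summable (\<lambda>k. c / real (blk k + 2) ^ 20)"
proof
  assume c: "0 < c" and s: "summable (\<lambda>k. c / real (blk k + 2) ^ 20)"
  have "summable (\<lambda>k. c / 3 ^ 20 * (1 / real (Suc k)))"
  proof (rule summable_comparison_test[OF _ s], intro exI allI impI)
    fix k :: nat
    have "real (blk k + 2) \<le> 3 * max 1 (real (blk k))" by (cases "blk k") auto
    then have "real (blk k + 2) ^ 20 \<le> (3 * max 1 (real (blk k))) ^ 20" by (rule power_mono) simp
    also have "\<dots> = 3 ^ 20 * max 1 (real (blk k)) ^ 20" by (rule power_mult_distrib)
    also have "max 1 (real (blk k)) ^ 20 \<le> real (Suc k)"
    proof (cases "blk k = 0")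
      case False
      then have "max 1 (real (blk k)) ^ 20 = real (blk k) ^ 20" by simp
      moreover have "real (blk k) ^ 20 \<le> real k"
        using of_nat_mono[OF blk_bounds(1)[of k], where 'a = real] by simp
      ultimately show ?thesis by linarith
    qed simp
    finally have "real (blk k + 2) ^ 20 \<le> 3 ^ 20 * real (Suc k)" by simp
    then have "c / (3 ^ 20 * real (Suc k)) \<le> c / real (blk k + 2) ^ 20"
      using c by (intro divide_left_mono mult_pos_pos) auto
    then show "norm (c / 3 ^ 20 * (1 / real (Suc k))) \<le> c / real (blk k + 2) ^ 20"
      using c by simp
  qed
  then have "summable (\<lambda>k. 1 / real (Suc k))"
    using c by (subst (asm) summable_cmult_iff) simp
  then show False
    using not_summable_harmonic[where 'a = real] summable_Suc_iff[of "\<lambda>k. inverse (real k)"]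
    by (simp add: inverse_eq_divide)
qed

text \<open>Both rates are at least of order n^-10, so the joint event at visit k has probability at
  least of order 1 / k. All indices k are considered, whether or not the node is ever visited that
  often.\<close>

lemma AE_explore_infinitely_often:
  assumes "i < m" "j < n"
  defines "I \<equiv> \<lambda>K i k. {real i * (rate K (blk k) / real K)..<real (Suc i) * (rate K (blk k) / real K)}"
  shows "AE \<omega> in mcts_space. \<exists>\<^sub>\<infinity>k. \<omega> (k, p, True) \<in> I m i k \<and> \<omega> (k, p, False) \<in> I n j k"
  unfolding mcts_space_def
proof (rule AE_infinitely_often_coordinate_pairs)
  have I: "emeasure unif (I K i k) = ennreal (rate K (blk k) / real K)" if "i < K" for K i k
  proof -
    define v where "v = rate K (blk k) / real K"
    have v: "0 \<le> v" using rate_pos[of K "blk k"] by (simp add: v_def)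
    have "real (Suc i) * v \<le> real K * v"
      using that v by (intro mult_right_mono) auto
    also have "\<dots> \<le> 1" using that rate_le_half[of K "blk k"] by (simp add: v_def)
    finally have "emeasure unif {real i * v..<real (Suc i) * v} = ennreal (real (Suc i) * v - real i * v)"
      using v by (intro emeasure_unif_Ico mult_right_mono) auto
    also have "real (Suc i) * v - real i * v = v" by (simp add: algebra_simps)
    finally show ?thesis by (simp add: I_def v_def)
  qed
  fix k
  have r: "1 / real (blk k + 2) ^ 10 * (1 / real (blk k + 2) ^ 10) \<le> rate m (blk k) * rate n (blk k)"
    using rate_pos by (intro mult_mono rate_ge) (auto intro: less_imp_le)
  have "1 / (real m * real n) / real (blk k + 2) ^ 20
      = 1 / (real m * real n) * (1 / real (blk k + 2) ^ 10 * (1 / real (blk k + 2) ^ 10))"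
    by (simp flip: power_add)
  also have "\<dots> \<le> 1 / (real m * real n) * (rate m (blk k) * rate n (blk k))"
    by (intro mult_left_mono r) auto
  finally have "1 / (real m * real n) / real (blk k + 2) ^ 20
      \<le> rate m (blk k) / real m * (rate n (blk k) / real n)" by simp
  then show "ennreal (1 / (real m * real n) / real (blk k + 2) ^ 20)
      \<le> emeasure unif (I m i k) * emeasure unif (I n j k)"
    using rate_pos[of m "blk k"] rate_pos[of n "blk k"] assms(1,2)
    by (simp add: I ennreal_mult[symmetric] ennreal_leI del: of_nat_add)
next
  show "\<not> summable (\<lambda>k. 1 / (real m * real n) / real (blk k + 2) ^ 20)"
    using assms(1,2) by (intro not_summable_exploration) auto
qed (auto simp: I_def disjoint_family_on_def)

theorem guaranteed_exploration_alg: "guaranteed_exploration alg"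
  unfolding guaranteed_exploration_def
proof (intro allI impI)
  fix G :: game and roll
  assume G: "wf_game G"
  let ?I = "\<lambda>K i k. {real i * (rate K (blk k) / real K)..<real (Suc i) * (rate K (blk k) / real K)}"
  have "AE \<omega> in mcts_space. \<forall>(p::path) m n i j. i < m \<longrightarrow> j < n \<longrightarrow>
      (\<exists>\<^sub>\<infinity>k. \<omega> (k, p, True) \<in> ?I m i k \<and> \<omega> (k, p, False) \<in> ?I n j k)"
  proof (simp only: AE_all_countable, intro allI)
    fix p :: path and m n i j :: nat
    show "AE \<omega> in mcts_space. i < m \<longrightarrow> j < n \<longrightarrow>
      (\<exists>\<^sub>\<infinity>k. \<omega> (k, p, True) \<in> ?I m i k \<and> \<omega> (k, p, False) \<in> ?I n j k)"
    proof (cases "i < m \<and> j < n")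
      case True
      with AE_explore_infinitely_often[of i m j n p] show ?thesis by (auto elim: eventually_mono)
    qed auto
  qed
  then show "AE \<omega> in mcts_space. \<forall>p\<in>nodes G.
      (\<forall>N. \<exists>t. N \<le> length (visits alg roll G \<omega> t p)) \<longrightarrow>
      (\<forall>i<acts1 G p. \<forall>j<acts2 G p. \<forall>N. \<exists>t.
        N \<le> length (filter (\<lambda>(a, b, x). a = i \<and> b = j) (visits alg roll G \<omega> t p)))"
  proof eventually_elim
    case (elim \<omega>)
    show ?case
    proof (intro ballI impI allI)
      fix p i j N
      assume p: "p \<in> nodes G" and inf: "\<forall>N. \<exists>t. N \<le> length (visits alg roll G \<omega> t p)"
        and i: "i < acts1 G p" and j: "j < acts2 G p"
      obtain m n c where sub: "subgame G p = Some (Node m n c)" using p by (auto simp: nodes_def)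
      then have ij: "i < m" "j < n" using i j by (auto simp: acts1_def acts2_def)
      define Ks where "Ks = {k. \<omega> (k, p, True) \<in> ?I m i k \<and> \<omega> (k, p, False) \<in> ?I n j k}"
      have "infinite Ks"
        using elim ij unfolding Ks_def INFM_iff_infinite by blast
      \<comment> \<open>N forcing indices lie below some L; once the node has been visited L times,
        all of them have taken effect.\<close>
      then obtain F where F: "F \<subseteq> Ks" "finite F" "card F = N"
        using infinite_arbitrarily_large by blast
      obtain L where L: "F \<subseteq> {..<L}" using F(2) finite_nat_iff_bounded by blast
      obtain t where t: "L \<le> length (visits alg roll G \<omega> t p)" using inf by blast
      let ?hs = "visits alg roll G \<omega> t p"
      have arms: "fst (?hs ! k) = i \<and> fst (snd (?hs ! k)) = j" if k: "k \<in> F" for k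
      proof -
        have lt: "k < length ?hs" using k L t by auto
        then obtain hs where hs: "mcts_state alg roll G \<omega> t p = Some hs" "?hs = hs"
          by (auto simp: visits_def split: option.splits)
        have "fst (hs ! k) = alg m (map (\<lambda>(i, j, x). (i, x)) (take k hs)) (\<omega> (k, p, True)) \<and>
          fst (snd (hs ! k)) = alg n (map (\<lambda>(i, j, x). (j, 1 - x)) (take k hs)) (\<omega> (k, p, False))"
          using consistent_visits_mcts_state[OF valid_alg_alg G, of \<omega> roll t] hs lt sub
          unfolding consistent_visits_def by fastforce
        moreover have "length (take k hs) = k" using lt hs by simp
        ultimately show ?thesis
          using k F(1) ij hs(2) by (auto simp: Ks_def intro!: alg_eq_explore)
      qed
      have "N = card F" using F by simp
      also have "\<dots> \<le> card {k. k < length ?hs \<and> (case ?hs ! k of (a, b, x) \<Rightarrow> a = i \<and> b = j)}"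
        using arms L t by (intro card_mono) (force simp: case_prod_beta)+
      also have "\<dots> = length (filter (\<lambda>(a, b, x). a = i \<and> b = j) ?hs)"
        by (simp add: length_filter_conv_card)
      finally show "\<exists>t. N \<le> length (filter (\<lambda>(a, b, x). a = i \<and> b = j) (visits alg roll G \<omega> t p))"
        by blast
    qed
  qed
qed

section \<open>Deviations from the prescribed pattern\<close>

lemma rate_nonneg: "0 \<le> rate K n"
  using rate_pos[of K n] by simp

lemma alg_eq_pat:
  fixes h :: hist and K :: nat
  defines "g \<equiv> rate K (blk (length h))"
  assumes K: "0 < K" and mode: "\<And>k. k < K \<Longrightarrow> cur K (rev h) k \<le> thr (blk (length h))"
    and u: "g \<le> u" "u < 1"
  shows "alg K h u = pat K (rev h)"
proof -
  let ?p = "pat K (rev h)"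
  have p: "?p < K" by (rule pat_less[OF K])
  have w1: "(\<Sum>l<K. wts K (rev h) l) = g" using K by (simp add: wts_def g_def)
  have w2: "wts K (rev h) (K + l) = (1 - g) * of_bool (l = ?p)" if "l < K" for l
    using that mode by (simp add: wts_def g_def mix_def)
  have "sample (wts K (rev h)) u = K + ?p"
  proof (rule sample_eq[OF wts_nonneg])
    have "(\<Sum>l<K + ?p. wts K (rev h) l) = g"
      using w1 w2 p by (simp add: sum_lessThan_add)
    then show "(\<Sum>l<K + ?p. wts K (rev h) l) \<le> u" "u < (\<Sum>l\<le>K + ?p. wts K (rev h) l)"
      using u w2[OF p] by (simp_all add: lessThan_Suc_atMost[symmetric])
  qed
  then show ?thesis using p by (simp add: alg_def)
qed

text \<open>Three cases. A correct prediction cancels the importance-weighted term, and an arm off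
  the pattern costs at most 1. A wrong prediction on the pattern arm has weight at most 2, because
  that arm has probability at least 1/2. Only a wrong prediction on an explored arm pays the full
  weight K / g. The bound holds pathwise, so in self-play it remains to count deviations.\<close>

lemma est_step_le:
  fixes r :: hist and K :: nat
  defines "g \<equiv> rate K (blk (length r))"
  assumes K: "0 < K" and mode: "\<And>k. k < K \<Longrightarrow> cur K r k \<le> thr (blk (length r))"
    and x: "0 \<le> x" "x \<le> 1" and a: "a < K"
  shows "est K ((a, x) # r) k \<le> cur K r k + (pred K r k - pred K r (pat K r))
     + (if x = pred K r a then of_bool (a \<noteq> pat K r) else if a = pat K r then 3 else 2 * real K / g)"
proof -
  let ?p = "arm_prob K r (cur K r)"
  have g: "0 < g" "g \<le> 1 / 2" using rate_pos rate_le_half by (simp_all add: g_def)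
  have e: "est K ((a, x) # r) k = cur K r k + pred K r k
      + of_bool (a = k) * (x - pred K r k) / ?p k - x - g"
    by (simp add: gain_est_def g_def)
  have ppos: "0 < ?p a" by (rule arm_prob_pos[OF K])
  show ?thesis
  proof (cases "x = pred K r a")
    case True
    then have "of_bool (a = k) * (x - pred K r k) / ?p k = 0" by simp
    moreover have "- x \<le> - pred K r (pat K r) + of_bool (a \<noteq> pat K r)"
      using True pred_bounds(1)[of K r a] pred_bounds(2)[of K r "pat K r"] by auto
    ultimately show ?thesis unfolding e if_P[OF True] using g by linarith
  next
    case False
    have "of_bool (a = k) * (x - pred K r k) / ?p k \<le> 1 / ?p a"
      using ppos x pred_bounds(1)[of K r k]
      by (cases "a = k") (auto intro!: divide_right_mono)
    then have le: "est K ((a, x) # r) k \<le> cur K r k + (pred K r k - pred K r (pat K r)) + 1 + 1 / ?p a"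
      unfolding e using g x pred_bounds(2)[of K r "pat K r"] by linarith
    show ?thesis
    proof (cases "a = pat K r")
      case True
      then have "mix K r (cur K r) a = 1" using mode by (simp add: mix_def)
      then have "?p a = g / real K + (1 - g)" by (simp add: arm_prob_def Let_def g_def)
      moreover have "0 \<le> g / real K" using g by simp
      ultimately have "1 / 2 \<le> ?p a" using g by linarith
      then have "1 / ?p a \<le> 2" using ppos by (simp add: divide_le_eq)
      then show ?thesis unfolding if_not_P[OF False] if_P[OF True] using le by linarith
    next
      case nf: False
      have "g / real K \<le> ?p a" unfolding g_def by (rule arm_prob_ge)
      then have "1 / ?p a \<le> 1 / (g / real K)"
        using g K ppos by (intro divide_left_mono mult_pos_pos divide_pos_pos) auto
      moreover have "1 \<le> real K / g" using g K by (simp add: le_divide_eq)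
      ultimately have "1 + 1 / ?p a \<le> 2 * real K / g" by simp
      then show ?thesis unfolding if_not_P[OF False] if_not_P[OF nf] using le by linarith
    qed
  qed
qed

lemma restart_Suc:
  assumes "n ^ 20 \<le> t" "Suc t < Suc n ^ 20"
  shows "restart (Suc t) e = e"
proof -
  have "blk (Suc t) = n" using assms by (intro blk_eqI) auto
  then show ?thesis using assms by (simp add: restart_def)
qed

text \<open>Outside of the deviation events the algorithm follows the pattern while its estimates
  are below the threshold.  They depend on the random source only.\<close>

definition deviates :: "nat \<Rightarrow> nat \<Rightarrow> real \<Rightarrow> bool" where
  "deviates K t u \<longleftrightarrow> \<not> (rate K (blk t) \<le> u \<and> u < 1)"

lemma emeasure_deviates: "emeasure unif {u. deviates K t u} = ennreal (rate K (blk t))"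
proof -
  interpret prob_space unif by (rule prob_space_unif)
  have "{u. deviates K t u} = space unif - {rate K (blk t)..<1}" by (auto simp: deviates_def)
  then have "emeasure unif {u. deviates K t u} = 1 - emeasure unif {rate K (blk t)..<1}"
    using emeasure_compl[of "{rate K (blk t)..<1}" unif] emeasure_space_1 by simp
  also have "\<dots> = ennreal 1 - ennreal (1 - rate K (blk t))"
    using rate_pos[of K "blk t"] rate_le_half[of K "blk t"] by (subst emeasure_unif_Ico) auto
  also have "\<dots> = ennreal (rate K (blk t))"
    using rate_le_half[of K "blk t"] by (subst ennreal_minus) auto
  finally show ?thesis .
qed

lemma deviates_sets: "{u. deviates K t u} \<in> sets borel"
  unfolding deviates_def by simp

lemma sum_blk: "(\<Sum>l<n ^ 20. f (blk l)) = (\<Sum>m<n. block_len m * f m)"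
proof (induction n)
  case (Suc n)
  have lt: "n ^ 20 < Suc n ^ 20" by (rule power_strict_mono) auto
  have "(\<Sum>l<Suc n ^ 20. f (blk l)) = (\<Sum>l<n ^ 20. f (blk l)) + (\<Sum>l\<in>{n ^ 20..<Suc n ^ 20}. f (blk l))"
    using lt by (subst sum.union_disjoint[symmetric]) (auto intro!: sum.cong)
  also have "(\<Sum>l\<in>{n ^ 20..<Suc n ^ 20}. f (blk l)) = (\<Sum>l\<in>{n ^ 20..<Suc n ^ 20}. f n)"
    by (intro sum.cong) (auto simp: blk_eqI)
  also have "\<dots> = real (Suc n ^ 20 - n ^ 20) * f n" by simp
  also have "real (Suc n ^ 20 - n ^ 20) = block_len n"
    using lt by (simp add: block_len_def of_nat_diff del: of_nat_Suc)
  finally show ?case using Suc by simp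
qed simp

text \<open>The expected number of events up to the end of block n has order at most n^(20-c).
  Weighted by n^d and divided by n^18, it is at most of order n^-2 by the last assumption.\<close>

lemma AE_event_count_tendsto_0:
  fixes E :: "nat \<Rightarrow> 'a set"
  assumes E: "\<And>l. E l \<in> sets M" "\<And>l. emeasure M (E l) \<le> ennreal (f (blk l))"
    and f: "\<And>m. 0 \<le> f m" "\<And>m. f m \<le> 1 / real (Suc m) ^ c" and c: "c \<le> 19" "d + (20 - c) \<le> 16"
  shows "AE x in M. (\<lambda>n. real (n + 2) ^ d * (\<Sum>l<Suc n ^ 20. of_bool (x \<in> E l)) / thr n) \<longlonglongrightarrow> 0"
proof (rule AE_tendsto_0_quadratic)
  fix n
  let ?w = "real (n + 2) ^ d / thr n"
  have w: "0 \<le> ?w" using thr_pos[of n] by simp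
  have [measurable]: "\<And>l. E l \<in> sets M" by (rule E)
  have "(\<lambda>x. \<Sum>l<Suc n ^ 20. indicator (E l) x :: real) \<in> borel_measurable M"
    by measurable
  then have m: "(\<lambda>x. \<Sum>l<Suc n ^ 20. of_bool (x \<in> E l) :: real) \<in> borel_measurable M"
    by (simp add: indicator_def of_bool_def)
  then show "(\<lambda>x. real (n + 2) ^ d * (\<Sum>l<Suc n ^ 20. of_bool (x \<in> E l)) / thr n) \<in> borel_measurable M"
    by measurable
  have "ennreal (real (n + 2) ^ d * (\<Sum>l<Suc n ^ 20. of_bool (x \<in> E l)) / thr n)
      = ennreal ?w * (\<Sum>l<Suc n ^ 20. indicator (E l) x)" for x
  proof -
    have "(\<Sum>l<Suc n ^ 20. indicator (E l) x :: ennreal) = ennreal (\<Sum>l<Suc n ^ 20. of_bool (x \<in> E l))"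
      by (subst sum_ennreal[symmetric]) (auto simp: indicator_def ennreal_of_nat_eq_real_of_nat)
    then show ?thesis using w by (simp add: ennreal_mult[symmetric] sum_nonneg)
  qed
  then have "(\<integral>\<^sup>+x. ennreal (real (n + 2) ^ d * (\<Sum>l<Suc n ^ 20. of_bool (x \<in> E l)) / thr n) \<partial>M)
      = ennreal ?w * (\<Sum>l<Suc n ^ 20. emeasure M (E l))"
    using E by (simp add: nn_integral_cmult nn_integral_sum)
  also have "\<dots> \<le> ennreal ?w * (\<Sum>l<Suc n ^ 20. ennreal (f (blk l)))"
    by (intro mult_left_mono sum_mono E) auto
  also have "\<dots> = ennreal (?w * (\<Sum>l<Suc n ^ 20. f (blk l)))"
    using w f by (simp add: sum_ennreal ennreal_mult[symmetric] sum_nonneg)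
  also have "\<dots> \<le> ennreal (2 ^ d * 20 / real (Suc n) ^ 2)"
  proof (rule ennreal_leI)
    have "(\<Sum>l<Suc n ^ 20. f (blk l)) = (\<Sum>m<Suc n. block_len m * f m)" by (rule sum_blk)
    also have "\<dots> \<le> (\<Sum>m<Suc n. 20 * real (Suc n) ^ (19 - c))"
    proof (rule sum_mono)
      fix m assume "m \<in> {..<Suc n}"
      then have mn: "real (Suc m) \<le> real (Suc n)" by simp
      have "block_len m * f m \<le> 20 * real (Suc m) ^ 19 * (1 / real (Suc m) ^ c)"
        using f by (intro mult_mono block_len_le) auto
      also have "\<dots> = 20 * real (Suc m) ^ (19 - c)"
        using c by (simp add: power_diff del: of_nat_Suc)
      also have "\<dots> \<le> 20 * real (Suc n) ^ (19 - c)"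
        using mn by (intro mult_left_mono power_mono) auto
      finally show "block_len m * f m \<le> 20 * real (Suc n) ^ (19 - c)" .
    qed
    also have "\<dots> = 20 * (real (Suc n) * real (Suc n) ^ (19 - c))" by simp
    also have "real (Suc n) * real (Suc n) ^ (19 - c) = real (Suc n) ^ (20 - c)"
    proof -
      have "20 - c = Suc (19 - c)" using c by simp
      then show ?thesis by (simp only: power_Suc)
    qed
    finally have s: "(\<Sum>l<Suc n ^ 20. f (blk l)) \<le> 20 * real (Suc n) ^ (20 - c)" .
    have "?w * (\<Sum>l<Suc n ^ 20. f (blk l)) \<le> (2 ^ d * real (Suc n) ^ d / thr n) * (20 * real (Suc n) ^ (20 - c))"
      using real_add2_power_le[of n d] thr_pos[of n] f
      by (intro mult_mono divide_right_mono s) (auto intro: sum_nonneg)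
    also have "\<dots> = 2 ^ d * 20 * (real (Suc n) ^ (d + (20 - c)) / real (Suc n) ^ 18)"
      by (simp add: thr_def power_add del: of_nat_Suc)
    also have "\<dots> \<le> 2 ^ d * 20 * (1 / real (Suc n) ^ 2)"
      using c by (intro mult_left_mono power_quotient_le) auto
    finally show "?w * (\<Sum>l<Suc n ^ 20. f (blk l)) \<le> 2 ^ d * 20 / real (Suc n) ^ 2" by simp
  qed
  finally show "(\<integral>\<^sup>+x. ennreal (real (n + 2) ^ d * (\<Sum>l<Suc n ^ 20. of_bool (x \<in> E l)) / thr n) \<partial>M)
      \<le> ennreal (2 ^ d * 20 / real (Suc n) ^ 2)" .
qed (auto simp: thr_pos less_imp_le intro!: divide_nonneg_nonneg mult_nonneg_nonneg sum_nonneg)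

definition dev1 :: "rand \<Rightarrow> nat \<Rightarrow> bool" where
  "dev1 \<omega> s \<longleftrightarrow> deviates 2 s (\<omega> (s, [(0, 0)], True))"

definition dev2 :: "rand \<Rightarrow> nat \<Rightarrow> bool" where
  "dev2 \<omega> s \<longleftrightarrow> deviates 3 s (\<omega> (s, [(0, 0)], False))"

definition dev_root :: "rand \<Rightarrow> nat \<Rightarrow> bool" where
  "dev_root \<omega> t \<longleftrightarrow> deviates 4 t (\<omega> (t, [], True))"

text \<open>Each count carries the weight of the errors it can cause: n^10 for coincidences in the
  inner game, n^4 for inner deviations, which mislead the root player, and 1 for his own. The sums
  start at 0 and not at the start of the block, since the inner game runs on its own slower clock
  and the root may meet inner deviations of much earlier index.\<close>

definition few_deviations :: "rand \<Rightarrow> nat \<Rightarrow> bool" where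
  "few_deviations \<omega> n \<longleftrightarrow>
     100 * real (n + 2) ^ 4 * (\<Sum>l<Suc n ^ 20. of_bool (dev1 \<omega> l)) \<le> thr n \<and>
     100 * real (n + 2) ^ 4 * (\<Sum>l<Suc n ^ 20. of_bool (dev2 \<omega> l)) \<le> thr n \<and>
     100 * real (n + 2) ^ 10 * (\<Sum>l<Suc n ^ 20. of_bool (dev1 \<omega> l \<and> dev2 \<omega> l)) \<le> thr n \<and>
     100 * (\<Sum>l<Suc n ^ 20. of_bool (dev_root \<omega> l)) \<le> thr n"

lemma rate_le_Suc_power:
  assumes "c \<le> (if K = 4 then 4 else 10)"
  shows "rate K m \<le> 1 / real (Suc m) ^ c"
proof -
  have "real (Suc m) ^ c \<le> real (m + 2) ^ c" by (rule power_mono) auto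
  also have "\<dots> \<le> real (m + 2) ^ (if K = 4 then 4 else 10)"
    using assms by (intro power_increasing) auto
  finally show ?thesis unfolding rate_def by (intro divide_left_mono) auto
qed

lemma AE_few_deviations: "AE \<omega> in mcts_space. eventually (few_deviations \<omega>) sequentially"
proof -
  let ?M = "mcts_space"
  have sp: "space ?M = UNIV" by (simp add: mcts_space_def space_PiM)
  have single: "{\<omega>. deviates K l (\<omega> i)} \<in> sets ?M"
      "emeasure ?M {\<omega>. deviates K l (\<omega> i)} \<le> ennreal (rate K (blk l))" for K l i
  proof -
    have "(\<lambda>\<omega>. \<omega> i) -` {u. deviates K l u} \<inter> space ?M \<in> sets ?M"
      unfolding mcts_space_def using deviates_sets by (intro measurable_sets[where A = unif]) auto
    then show "{\<omega>. deviates K l (\<omega> i)} \<in> sets ?M" by (simp add: sp vimage_def)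
    show "emeasure ?M {\<omega>. deviates K l (\<omega> i)} \<le> ennreal (rate K (blk l))"
      using emeasure_coordinate[where i = i, OF deviates_sets[of K l]] emeasure_deviates[of K l]
      by (simp add: mcts_space_def)
  qed
  have both: "emeasure ?M {\<omega>. deviates 2 l (\<omega> i) \<and> deviates 3 l (\<omega> j)}
      \<le> ennreal (rate 2 (blk l) * rate 3 (blk l))" if "i \<noteq> j" for l i j
    using emeasure_coordinate2[OF deviates_sets[of 2 l] deviates_sets[of 3 l] that]
      by (simp add: mcts_space_def emeasure_deviates ennreal_mult rate_nonneg)
  \<comment> \<open>One of the twenty powers is given away: with exponent 20 the expected count
    would be a logarithm, which the power bound above does not cover.\<close>
  have prod: "rate 2 m * rate 3 m \<le> 1 / real (Suc m) ^ 19" for m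
  proof -
    have "rate 2 m * rate 3 m \<le> 1 / real (Suc m) ^ 9 * (1 / real (Suc m) ^ 10)"
      by (intro mult_mono rate_le_Suc_power rate_nonneg) auto
    then show ?thesis by (simp flip: power_add del: of_nat_Suc)
  qed
  have lim: "eventually (\<lambda>n. 100 * w n * S n \<le> thr n) sequentially"
    if "(\<lambda>n. w n * S n / thr n) \<longlonglongrightarrow> 0" for w S
  proof -
    have "eventually (\<lambda>n. w n * S n / thr n < 1 / 100) sequentially"
      using that by (rule order_tendstoD) simp
    then show ?thesis by eventually_elim (use thr_pos in \<open>simp add: divide_less_eq\<close>)
  qed
  have one: "AE \<omega> in ?M. eventually (\<lambda>n. 100 * real (n + 2) ^ d
      * (\<Sum>l<Suc n ^ 20. of_bool (deviates K l (\<omega> (i l)))) \<le> thr n) sequentially"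
    if "c \<le> (if K = 4 then 4 else 10)" "d + (20 - c) \<le> 16" for K c d i
  proof -
    have "AE \<omega> in ?M. (\<lambda>n. real (n + 2) ^ d
        * (\<Sum>l<Suc n ^ 20. of_bool (\<omega> \<in> {\<omega>. deviates K l (\<omega> (i l))})) / thr n) \<longlonglongrightarrow> 0"
      using that rate_nonneg
      by (intro AE_event_count_tendsto_0[where f = "rate K" and c = c] single rate_le_Suc_power)
        (auto split: if_splits)
    then show ?thesis by eventually_elim (rule lim, simp only: mem_Collect_eq)
  qed
  have "AE \<omega> in ?M. eventually (\<lambda>n. 100 * real (n + 2) ^ 4 * (\<Sum>l<Suc n ^ 20. of_bool (dev1 \<omega> l)) \<le> thr n) sequentially"
    unfolding dev1_def by (rule one[where c = 10]) auto
  moreover have "AE \<omega> in ?M. eventually (\<lambda>n. 100 * real (n + 2) ^ 4 * (\<Sum>l<Suc n ^ 20. of_bool (dev2 \<omega> l)) \<le> thr n) sequentially"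
    unfolding dev2_def by (rule one[where c = 10]) auto
  moreover have "AE \<omega> in ?M. eventually (\<lambda>n. 100 * real (n + 2) ^ 10 * (\<Sum>l<Suc n ^ 20. of_bool (dev1 \<omega> l \<and> dev2 \<omega> l)) \<le> thr n) sequentially"
  proof -
    let ?E = "\<lambda>l. {\<omega>. deviates 2 l (\<omega> (l, [(0, 0)], True)) \<and> deviates 3 l (\<omega> (l, [(0, 0)], False))}"
    have "?E l \<in> sets ?M" for l
      unfolding Collect_conj_eq by (intro sets.Int single)
    then have "AE \<omega> in ?M. (\<lambda>n. real (n + 2) ^ 10 * (\<Sum>l<Suc n ^ 20. of_bool (\<omega> \<in> ?E l)) / thr n) \<longlonglongrightarrow> 0"
      by (rule AE_event_count_tendsto_0[where f = "\<lambda>m. rate 2 m * rate 3 m" and c = 19])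
        (use prod in \<open>auto simp: both rate_nonneg\<close>)
    then show ?thesis by eventually_elim (rule lim, simp only: mem_Collect_eq dev1_def dev2_def)
  qed
  moreover have "AE \<omega> in ?M. eventually (\<lambda>n. 100 * real (n + 2) ^ 0 * (\<Sum>l<Suc n ^ 20. of_bool (dev_root \<omega> l)) \<le> thr n) sequentially"
    unfolding dev_root_def by (rule one[where c = 4]) auto
  ultimately show ?thesis
    unfolding few_deviations_def by eventually_elim (simp add: eventually_conj_iff)
qed

section \<open>Self-play\<close>

fun joint_step :: "rand \<Rightarrow> nat \<Rightarrow> hist \<times> hist \<Rightarrow> nat \<times> nat" where
  "joint_step \<omega> s (r1, r2) =
     (alg 2 (rev r1) (\<omega> (s, [(0, 0)], True)), alg 3 (rev r2) (\<omega> (s, [(0, 0)], False)))"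

text \<open>Random numbers are indexed by the visit count of the node, so the inner play is a
  process with its own clock s, independent of when the root enters.\<close>

primrec joint :: "rand \<Rightarrow> nat \<Rightarrow> hist \<times> hist" where
  "joint \<omega> 0 = ([], [])"
| "joint \<omega> (Suc s) =
     (let (i, j) = joint_step \<omega> s (joint \<omega> s)
      in ((i, pay i j) # fst (joint \<omega> s), (j, 1 - pay i j) # snd (joint \<omega> s)))"

definition inner_val :: "rand \<Rightarrow> nat \<Rightarrow> real" where
  "inner_val \<omega> s = (case joint_step \<omega> s (joint \<omega> s) of (i, j) \<Rightarrow> pay i j)"

lemma length_joint [simp]: "length (fst (joint \<omega> s)) = s" "length (snd (joint \<omega> s)) = s"
  by (induction s) (simp_all add: case_prod_beta)

lemma pay_bounds: "0 \<le> pay i j" "pay i j \<le> 1"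
  by (auto simp: pay_def)

text \<open>Over one period of length four both patterns earn as much as every fixed arm, hence the
  accumulated difference of the predictions is a function of the time modulo four.\<close>

definition drift1 :: "nat \<Rightarrow> nat \<Rightarrow> real" where
  "drift1 k s = - of_bool (if k = 0 then s mod 4 = 3 else s mod 4 = 1)"

definition drift2 :: "nat \<Rightarrow> nat \<Rightarrow> real" where
  "drift2 k s = (if k = 0 then - of_bool (s mod 4 = 2) else of_bool (s mod 4 \<noteq> 0))"

lemma mod4_cases: "s mod 4 = 0 \<or> s mod 4 = 1 \<or> s mod 4 = 2 \<or> s mod 4 = (3::nat)"
  by linarith

lemma drift1_Suc:
  assumes "length r = s"
  shows "pred 2 r k - pred 2 r (pat 2 r) = drift1 k (Suc s) - drift1 k s"
  using mod4_cases[of s] assms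
  by (auto simp: pred_def pat_def pay_def drift1_def mod_Suc)

lemma drift2_Suc:
  assumes "length r = s"
  shows "pred 3 r k - pred 3 r (pat 3 r) = drift2 k (Suc s) - drift2 k s"
  using mod4_cases[of s] assms
  by (auto simp: pred_def pat_def pay_def drift2_def mod_Suc)

lemma pat_length_cong:
  "length r = length r' \<Longrightarrow> pat 2 r = pat 2 r'" "length r = length r' \<Longrightarrow> pat 3 r = pat 3 r'"
  by (simp_all add: pat_def)

text \<open>Induction along the block, for both players at once, because the predictions of each
  rely on the other being below the threshold. Apart from the bounded periodic drift, only
  deviations move the estimates, and their total stays below the threshold.\<close>

lemma inner_modes:
  assumes few: "few_deviations \<omega> n" and n: "0 < n" and s: "n ^ 20 \<le> s" "s < Suc n ^ 20"
  shows "(\<forall>k. cur 2 (fst (joint \<omega> s)) k \<le> thr n) \<and> (\<forall>k. cur 3 (snd (joint \<omega> s)) k \<le> thr n)"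
proof -
  \<comment> \<open>The 3 covers an own deviation under a correct prediction as well as a wrong
    prediction on the pattern arm. When both players deviate, the weight is 2 K / rate, and 6 = 2 *
    3 serves both K = 2 and K = 3.\<close>
  define inc where "inc l = 3 * of_bool (dev1 \<omega> l) + 3 * of_bool (dev2 \<omega> l)
      + 6 * real (n + 2) ^ 10 * of_bool (dev1 \<omega> l \<and> dev2 \<omega> l)" for l
  have inc0: "0 \<le> inc l" for l by (simp add: inc_def)
  define Z where "Z t = (\<Sum>l\<in>{n ^ 20..<t}. inc l)" for t
  have Zle: "2 + Z t \<le> thr n" if "t \<le> Suc n ^ 20" for t
  proof -
    have "Z t \<le> (\<Sum>l<Suc n ^ 20. inc l)"
      unfolding Z_def using that inc0 by (intro sum_mono2) auto
    also have "\<dots> = 3 * (\<Sum>l<Suc n ^ 20. of_bool (dev1 \<omega> l)) + 3 * (\<Sum>l<Suc n ^ 20. of_bool (dev2 \<omega> l))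
        + 6 * real (n + 2) ^ 10 * (\<Sum>l<Suc n ^ 20. of_bool (dev1 \<omega> l \<and> dev2 \<omega> l))"
      unfolding inc_def sum.distrib sum_distrib_left ..
    finally have Z: "Z t \<le> \<dots>" .
    have "100 * (\<Sum>l<Suc n ^ 20. of_bool (dev1 \<omega> l)) \<le> thr n"
        "100 * (\<Sum>l<Suc n ^ 20. of_bool (dev2 \<omega> l)) \<le> thr n"
    proof -
      have "100 * x \<le> 100 * real (n + 2) ^ 4 * x" if "0 \<le> x" for x :: real
      proof -
        have "1 \<le> real (n + 2) ^ 4" by (rule one_le_power) simp
        then have "100 * x \<le> (100 * real (n + 2) ^ 4) * x" using that by (intro mult_right_mono) auto
        then show ?thesis .
      qed
      note drop = order_trans[OF this]
      have "0 \<le> (\<Sum>l<L. of_bool (P l) :: real)" for P and L :: nat by (intro sum_nonneg) simp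
      then show "100 * (\<Sum>l<Suc n ^ 20. of_bool (dev1 \<omega> l)) \<le> thr n"
        "100 * (\<Sum>l<Suc n ^ 20. of_bool (dev2 \<omega> l)) \<le> thr n"
        using few unfolding few_deviations_def by (blast intro: drop)+
    qed
    moreover have "100 * real (n + 2) ^ 10 * (\<Sum>l<Suc n ^ 20. of_bool (dev1 \<omega> l \<and> dev2 \<omega> l)) \<le> thr n"
      using few unfolding few_deviations_def by blast
    moreover have "100 \<le> thr n"
    proof -
      have "(2::real) ^ 18 \<le> real (Suc n) ^ 18" using n by (intro power_mono) auto
      then show ?thesis by (simp add: thr_def)
    qed
    ultimately show ?thesis using Z by linarith
  qed
  have d1: "\<bar>drift1 k s - drift1 k s'\<bar> \<le> 1" and d2: "\<bar>drift2 k s - drift2 k s'\<bar> \<le> 1" for k s s'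
    by (auto simp: drift1_def drift2_def)
  have "(\<forall>k. cur 2 (fst (joint \<omega> s)) k \<le> drift1 k s - drift1 k (n ^ 20) + Z s) \<and>
        (\<forall>k. cur 3 (snd (joint \<omega> s)) k \<le> drift2 k s - drift2 k (n ^ 20) + Z s)"
    using s
  proof (induction s rule: dec_induct)
    case base
    have "blk (n ^ 20) = n" by (intro blk_eqI power_strict_mono) auto
    then show ?case by (simp add: restart_def Z_def)
  next
    case (step s)
    let ?r1 = "fst (joint \<omega> s)" let ?r2 = "snd (joint \<omega> s)"
    obtain i j where ij: "joint_step \<omega> s (joint \<omega> s) = (i, j)" by (cases "joint_step \<omega> s (joint \<omega> s)")
    have b: "blk s = n" using step.prems step.hyps by (intro blk_eqI) auto
    have IH: "cur 2 ?r1 k \<le> drift1 k s - drift1 k (n ^ 20) + Z s"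
      "cur 3 ?r2 k \<le> drift2 k s - drift2 k (n ^ 20) + Z s" for k
      using step by auto
    have m1: "cur 2 ?r1 k \<le> thr (blk (length ?r1))" and m2: "cur 3 ?r2 k \<le> thr (blk (length ?r2))" for k
      using IH[of k] d1[of k s "n ^ 20"] d2[of k s "n ^ 20"] Zle[of s] step.prems b by simp_all
    have i: "i = alg 2 (rev ?r1) (\<omega> (s, [(0, 0)], True))"
      and j: "j = alg 3 (rev ?r2) (\<omega> (s, [(0, 0)], False))"
      using ij by (cases "joint \<omega> s"; simp)+
    have il: "i < 2" "j < 3" using valid_alg_alg by (auto simp: i j valid_alg_def)
    have pi: "i = pat 2 ?r1" if "\<not> dev1 \<omega> s"
      unfolding i using that m1 by (subst alg_eq_pat) (auto simp: dev1_def deviates_def)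
    have pj: "j = pat 3 ?r2" if "\<not> dev2 \<omega> s"
      unfolding j using that m2 by (subst alg_eq_pat) (auto simp: dev2_def deviates_def)
    have rt: "1 / rate 2 n = real (n + 2) ^ 10" "1 / rate 3 n = real (n + 2) ^ 10"
      by (simp_all add: rate_def)
    have big: "4 \<le> 6 * real (n + 2) ^ 10"
    proof -
      have "1 \<le> real (n + 2) ^ 10" by (rule one_le_power) simp
      then show ?thesis by linarith
    qed
    have J: "joint \<omega> (Suc s) = ((i, pay i j) # ?r1, (j, 1 - pay i j) # ?r2)"
      by (simp add: ij)
    have rs: "cur 2 (fst (joint \<omega> (Suc s))) = est 2 ((i, pay i j) # ?r1)"
      "cur 3 (snd (joint \<omega> (Suc s))) = est 3 ((j, 1 - pay i j) # ?r2)"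
      using restart_Suc[OF step.hyps(1) step.prems] by (simp_all add: J del: joint.simps est.simps)
    have ZS: "Z (Suc s) = Z s + inc s" unfolding Z_def using step.hyps by simp
    have pr1: "pay i j = pred 2 ?r1 i" if "\<not> dev2 \<omega> s"
      using pj[OF that] pat_length_cong(2)[of ?r1 ?r2] by (simp add: pred_def)
    have pr2: "1 - pay i j = pred 3 ?r2 j" if "\<not> dev1 \<omega> s"
      using pi[OF that] pat_length_cong(1)[of ?r1 ?r2] by (simp add: pred_def)
    have "est 2 ((i, pay i j) # ?r1) k \<le> cur 2 ?r1 k + (drift1 k (Suc s) - drift1 k s) + inc s" for k
    proof -
      have "est 2 ((i, pay i j) # ?r1) k \<le> cur 2 ?r1 k + (pred 2 ?r1 k - pred 2 ?r1 (pat 2 ?r1))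
        + (if pay i j = pred 2 ?r1 i then of_bool (i \<noteq> pat 2 ?r1) else if i = pat 2 ?r1 then 3
           else 2 * real 2 / rate 2 (blk (length ?r1)))"
        using m1 il by (intro est_step_le) (auto simp: pay_bounds)
      also have "(if pay i j = pred 2 ?r1 i then of_bool (i \<noteq> pat 2 ?r1) else if i = pat 2 ?r1 then 3
           else 2 * real 2 / rate 2 (blk (length ?r1))) \<le> inc s"
        using pi pr1 rt big by (cases "dev1 \<omega> s"; cases "dev2 \<omega> s") (auto simp: inc_def b rate_def)
      also have "pred 2 ?r1 k - pred 2 ?r1 (pat 2 ?r1) = drift1 k (Suc s) - drift1 k s"
        by (rule drift1_Suc) simp
      finally show ?thesis by simp
    qed
    moreover have "est 3 ((j, 1 - pay i j) # ?r2) k \<le> cur 3 ?r2 k + (drift2 k (Suc s) - drift2 k s) + inc s" for k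
    proof -
      have "est 3 ((j, 1 - pay i j) # ?r2) k \<le> cur 3 ?r2 k + (pred 3 ?r2 k - pred 3 ?r2 (pat 3 ?r2))
        + (if 1 - pay i j = pred 3 ?r2 j then of_bool (j \<noteq> pat 3 ?r2) else if j = pat 3 ?r2 then 3
           else 2 * real 3 / rate 3 (blk (length ?r2)))"
        using m2 il by (intro est_step_le) (auto simp: pay_bounds)
      also have "(if 1 - pay i j = pred 3 ?r2 j then of_bool (j \<noteq> pat 3 ?r2) else if j = pat 3 ?r2 then 3
           else 2 * real 3 / rate 3 (blk (length ?r2))) \<le> inc s"
        using pj pr2 rt big by (cases "dev1 \<omega> s"; cases "dev2 \<omega> s") (auto simp: inc_def b rate_def)
      also have "pred 3 ?r2 k - pred 3 ?r2 (pat 3 ?r2) = drift2 k (Suc s) - drift2 k s"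
        by (rule drift2_Suc) simp
      finally show ?thesis by simp
    qed
    ultimately show ?case unfolding rs ZS using IH by (smt (verit))
  qed
  then have "cur 2 (fst (joint \<omega> s)) k \<le> thr n" "cur 3 (snd (joint \<omega> s)) k \<le> thr n" for k
    using d1[of k s "n ^ 20"] d2[of k s "n ^ 20"] Zle[of s] s by (smt (verit) less_imp_le)+
  then show ?thesis by blast
qed

lemma inner_val_eq:
  assumes "few_deviations \<omega> (blk s)" "0 < blk s" "\<not> dev1 \<omega> s" "\<not> dev2 \<omega> s"
  shows "inner_val \<omega> s = of_bool (even s)"
proof -
  let ?r1 = "fst (joint \<omega> s)" let ?r2 = "snd (joint \<omega> s)"
  have m: "(\<forall>k. cur 2 ?r1 k \<le> thr (blk s)) \<and> (\<forall>k. cur 3 ?r2 k \<le> thr (blk s))"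
    using assms(1,2) blk_bounds by (rule inner_modes)
  have "alg 2 (rev ?r1) (\<omega> (s, [(0, 0)], True)) = pat 2 ?r1"
    using m assms(3) by (subst alg_eq_pat) (auto simp: dev1_def deviates_def)
  moreover have "alg 3 (rev ?r2) (\<omega> (s, [(0, 0)], False)) = pat 3 ?r2"
    using m assms(4) by (subst alg_eq_pat) (auto simp: dev2_def deviates_def)
  moreover have "joint_step \<omega> s (joint \<omega> s) =
      (alg 2 (rev ?r1) (\<omega> (s, [(0, 0)], True)), alg 3 (rev ?r2) (\<omega> (s, [(0, 0)], False)))"
    by (cases "joint \<omega> s") simp
  ultimately have "inner_val \<omega> s = pay (pat 2 ?r1) (pat 3 ?r2)"
    by (simp add: inner_val_def)
  moreover have "even s \<longleftrightarrow> s mod 4 \<in> {0, 2}" by (simp add: even_iff_mod_2_eq_zero) presburger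
  ultimately show ?thesis using mod4_cases[of s] by (auto simp: pat_def pay_def)
qed

lemma inner_val_bounds: "0 \<le> inner_val \<omega> s" "inner_val \<omega> s \<le> 1"
  by (simp_all add: inner_val_def pay_bounds split: prod.split)

section \<open>The root player in self-play\<close>

text \<open>The entry numbered 0 adds the inner node and returns the rollout value, hence the shift
  \<open>zeros r - 1\<close>. Player 2 has a single arm at the root and leaves no trace.\<close>

primrec root_hist :: "rand \<Rightarrow> (path \<Rightarrow> real) \<Rightarrow> nat \<Rightarrow> hist" where
  "root_hist \<omega> roll 0 = []"
| "root_hist \<omega> roll (Suc t) =
     (let r = root_hist \<omega> roll t; a = alg 4 (rev r) (\<omega> (t, [], True))
      in (a, if a \<noteq> 0 then 0 else if zeros r = 0 then roll [(0, 0)] else inner_val \<omega> (zeros r - 1)) # r)"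

lemma length_root_hist [simp]: "length (root_hist \<omega> roll t) = t"
  by (induction t) (simp_all add: Let_def)

lemma zeros_Cons: "zeros (y # r) = zeros r + of_bool (fst y = 0)"
  by (simp add: zeros_def)

lemma zeros_le: "zeros r \<le> length r"
  by (simp add: zeros_def)

definition surprise :: "rand \<Rightarrow> (path \<Rightarrow> real) \<Rightarrow> nat \<Rightarrow> bool" where
  "surprise \<omega> roll t \<longleftrightarrow> (case hd (root_hist \<omega> roll (Suc t)) of (a, x) \<Rightarrow>
     x \<noteq> pred 4 (root_hist \<omega> roll t) a)"

text \<open>Every inner value is received at most once, at the entry that uses up its index. The 1
  stands for the first entry, whose rollout value is arbitrary.\<close>

lemma sum_surprise_le:
  "(\<Sum>l<t. of_bool (surprise \<omega> roll l)) \<le> (1::real)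
     + (\<Sum>s<t. of_bool (inner_val \<omega> s \<noteq> of_bool (even s)))"
proof -
  let ?z = "\<lambda>t. zeros (root_hist \<omega> roll t)"
  let ?B = "\<lambda>s. of_bool (inner_val \<omega> s \<noteq> of_bool (even s)) :: real"
  have "(\<Sum>l<t. of_bool (surprise \<omega> roll l)) \<le> of_bool (0 < ?z t) + (\<Sum>s<?z t - 1. ?B s)"
  proof (induction t)
    case (Suc t)
    let ?r = "root_hist \<omega> roll t"
    define a where "a = alg 4 (rev ?r) (\<omega> (t, [], True))"
    have h: "root_hist \<omega> roll (Suc t) = (a, if a \<noteq> 0 then 0 else if zeros ?r = 0 then roll [(0, 0)]
        else inner_val \<omega> (zeros ?r - 1)) # ?r"
      by (simp add: a_def Let_def)
    show ?case
    proof (cases "a = 0")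
      case False
      then have "\<not> surprise \<omega> roll t" unfolding surprise_def h by (simp add: pred_def)
      moreover have "?z (Suc t) = ?z t" unfolding h zeros_Cons using False by simp
      ultimately show ?thesis using Suc by simp
    next
      case True
      have z: "?z (Suc t) = Suc (?z t)" unfolding h zeros_Cons using True by simp
      show ?thesis
      proof (cases "?z t")
        case 0
        then show ?thesis using Suc z by simp
      next
        case (Suc m)
        have "surprise \<omega> roll t \<longleftrightarrow> inner_val \<omega> m \<noteq> of_bool (even m)"
          unfolding surprise_def h using True Suc by (simp add: pred_def)
        then show ?thesis using Suc.IH z Suc by (simp del: root_hist.simps)
      qed
    qed
  qed simp
  also have "\<dots> \<le> 1 + (\<Sum>s<t. ?B s)"
    using zeros_le[of "root_hist \<omega> roll t"] by (intro add_mono sum_mono2) auto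
  finally show ?thesis .
qed

text \<open>Inner visits before block N may go wrong arbitrarily and are charged in full; afterwards
  an unexpected value needs a deviation of one of the players.\<close>

lemma sum_inner_val_deviations_le:
  assumes few: "\<And>n. N \<le> n \<Longrightarrow> few_deviations \<omega> n" and N: "0 < N"
  shows "(\<Sum>s<t. of_bool (inner_val \<omega> s \<noteq> of_bool (even s))) \<le> real (N ^ 20)
     + (\<Sum>s<t. of_bool (dev1 \<omega> s)) + (\<Sum>s<t. of_bool (dev2 \<omega> s))"
proof -
  have "(of_bool (inner_val \<omega> s \<noteq> of_bool (even s)) :: real)
      \<le> of_bool (s < N ^ 20) + of_bool (dev1 \<omega> s) + of_bool (dev2 \<omega> s)" for s
  proof (cases "s < N ^ 20 \<or> dev1 \<omega> s \<or> dev2 \<omega> s")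
    case False
    then have "N \<le> blk s" by (intro blk_ge) simp
    then have "inner_val \<omega> s = of_bool (even s)"
      using False N by (intro inner_val_eq few) auto
    then show ?thesis by simp
  qed auto
  then have "(\<Sum>s<t. of_bool (inner_val \<omega> s \<noteq> of_bool (even s)) :: real)
      \<le> (\<Sum>s<t. of_bool (s < N ^ 20) + of_bool (dev1 \<omega> s) + of_bool (dev2 \<omega> s))"
    by (rule sum_mono)
  also have "\<dots> = (\<Sum>s<t. of_bool (s < N ^ 20)) + (\<Sum>s<t. of_bool (dev1 \<omega> s)) + (\<Sum>s<t. of_bool (dev2 \<omega> s))"
    by (simp only: sum.distrib)
  also have "(\<Sum>s<t. of_bool (s < N ^ 20) :: real) \<le> real (N ^ 20)"
  proof -
    have "(\<Sum>s<t. of_bool (s < N ^ 20) :: real) = real (card ({..<t} \<inter> {s. s < N ^ 20}))" by simp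
    also have "\<dots> \<le> real (card {..<N ^ 20})" by (intro of_nat_mono card_mono) auto
    finally show ?thesis by simp
  qed
  finally show ?thesis by simp
qed

lemma root_mode:
  assumes few: "\<And>n. N \<le> n \<Longrightarrow> few_deviations \<omega> n" and N: "0 < N"
    and n: "N \<le> n" "600 * (1 + real (N ^ 20)) \<le> real (Suc n)"
    and t: "n ^ 20 \<le> t" "t < Suc n ^ 20" and roll: "valid_roll roll"
  shows "\<forall>k<4. cur 4 (root_hist \<omega> roll t) k \<le> thr n"
proof -
  define w where "w = real (n + 2) ^ 4"
  have w: "1 \<le> w" unfolding w_def by (rule one_le_power) simp
  \<comment> \<open>Every surprise is charged the full weight 2 * 4 / rate, whether or not the root
    player deviates at that time; the faster exploration at the root makes this affordable.\<close>
  define inc where "inc l = of_bool (dev_root \<omega> l) + 8 * w * of_bool (surprise \<omega> roll l)" for l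
  have inc0: "0 \<le> inc l" for l using w by (simp add: inc_def)
  define Z where "Z t = (\<Sum>l\<in>{n ^ 20..<t}. inc l)" for t
  have Zle: "Z t \<le> thr n" if "t \<le> Suc n ^ 20" for t
  proof -
    let ?L = "Suc n ^ 20"
    have "Z t \<le> (\<Sum>l<?L. inc l)"
      unfolding Z_def using that inc0 by (intro sum_mono2) auto
    also have "\<dots> = (\<Sum>l<?L. of_bool (dev_root \<omega> l)) + 8 * w * (\<Sum>l<?L. of_bool (surprise \<omega> roll l))"
      unfolding inc_def sum.distrib sum_distrib_left ..
    also have "(\<Sum>l<?L. of_bool (surprise \<omega> roll l))
        \<le> 1 + (real (N ^ 20) + (\<Sum>s<?L. of_bool (dev1 \<omega> s)) + (\<Sum>s<?L. of_bool (dev2 \<omega> s)))"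
      by (rule order_trans[OF sum_surprise_le add_left_mono[OF sum_inner_val_deviations_le[OF few N]]])
    finally have Z: "Z t \<le> (\<Sum>l<?L. of_bool (dev_root \<omega> l)) + 8 * (w * (1 + real (N ^ 20)))
        + 8 * (w * (\<Sum>s<?L. of_bool (dev1 \<omega> s))) + 8 * (w * (\<Sum>s<?L. of_bool (dev2 \<omega> s)))"
      using w by (simp add: algebra_simps mult_left_mono)
    \<comment> \<open>The 16 is 2^4 from n + 2 \<le> 2 (n + 1). The 600 in the assumption on n turns
      the fixed loss of the early blocks into a small fraction of \<open>thr n\<close>.\<close>
    have "w * (1 + real (N ^ 20)) \<le> 16 * real (Suc n) ^ 4 * (real (Suc n) / 600)"
      using n(2) real_add2_power_le[of n 4] unfolding w_def by (intro mult_mono) auto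
    also have "\<dots> = 16 / 600 * real (Suc n) ^ 5"
      using power_Suc[of "real (Suc n)" 4] by (simp add: mult.commute del: of_nat_Suc)
    also have "\<dots> \<le> 16 / 600 * thr n"
      unfolding thr_def by (intro mult_left_mono power_increasing) auto
    finally have 1: "w * (1 + real (N ^ 20)) \<le> 16 / 600 * thr n" .
    have "100 * (w * (\<Sum>l<?L. of_bool (dev1 \<omega> l))) \<le> thr n"
        "100 * (w * (\<Sum>l<?L. of_bool (dev2 \<omega> l))) \<le> thr n"
        "100 * (\<Sum>l<?L. of_bool (dev_root \<omega> l)) \<le> thr n"
      using few[OF n(1)] unfolding few_deviations_def w_def by (simp_all only: mult.assoc)
    then show ?thesis using Z 1 thr_pos[of n] by linarith
  qed
  have "\<forall>k. cur 4 (root_hist \<omega> roll t) k \<le> Z t"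
    using t
  proof (induction t rule: dec_induct)
    case base
    have "blk (n ^ 20) = n" by (intro blk_eqI power_strict_mono) auto
    then show ?case by (simp add: restart_def Z_def)
  next
    case (step t)
    let ?r = "root_hist \<omega> roll t"
    obtain a x where h: "root_hist \<omega> roll (Suc t) = (a, x) # ?r" and a: "a = alg 4 (rev ?r) (\<omega> (t, [], True))"
      by (simp add: Let_def)
    have b: "blk t = n" using step.prems step.hyps by (intro blk_eqI) auto
    have IH: "cur 4 ?r k \<le> Z t" for k using step by auto
    have m: "cur 4 ?r k \<le> thr (blk (length ?r))" for k
      using IH[of k] Zle[of t] step.prems b by simp
    have al: "a < 4" using valid_alg_alg by (auto simp: a valid_alg_def)
    have pa: "a = pat 4 ?r" if "\<not> dev_root \<omega> t"
      unfolding a using that m by (subst alg_eq_pat) (auto simp: dev_root_def deviates_def)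
    have sp: "x = pred 4 ?r a" if "\<not> surprise \<omega> roll t"
      using that unfolding surprise_def h by simp
    have rt: "1 / rate 4 n = w" by (simp add: rate_def w_def)
    have rs: "cur 4 (root_hist \<omega> roll (Suc t)) = est 4 ((a, x) # ?r)"
      using restart_Suc[OF step.hyps(1) step.prems] by (simp add: h del: root_hist.simps est.simps)
    have ZS: "Z (Suc t) = Z t + inc t" unfolding Z_def using step.hyps by simp
    have x: "0 \<le> x" "x \<le> 1"
      using h roll inner_val_bounds by (auto simp: Let_def valid_roll_def)
    have "est 4 ((a, x) # ?r) k \<le> cur 4 ?r k + inc t" for k
    proof -
      have "est 4 ((a, x) # ?r) k \<le> cur 4 ?r k + (pred 4 ?r k - pred 4 ?r (pat 4 ?r))
        + (if x = pred 4 ?r a then of_bool (a \<noteq> pat 4 ?r) else if a = pat 4 ?r then 3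
           else 2 * real 4 / rate 4 (blk (length ?r)))"
        using m al x by (intro est_step_le) auto
      also have "(if x = pred 4 ?r a then of_bool (a \<noteq> pat 4 ?r) else if a = pat 4 ?r then 3
           else 2 * real 4 / rate 4 (blk (length ?r))) \<le> inc t"
        using pa sp rt w by (cases "dev_root \<omega> t"; cases "surprise \<omega> roll t") (auto simp: inc_def b rate_def)
      \<comment> \<open>The heart of the counterexample: at an odd count the pattern enters for the
        only reward predicted to be 1, and at an even count all predictions are 0, so waiting loses
        nothing.\<close>
      also have "pred 4 ?r k - pred 4 ?r (pat 4 ?r) \<le> 0"
        by (auto simp: pred_def pat_def)
      finally show ?thesis by simp
    qed
    then show ?case unfolding rs ZS using IH by (smt (verit))
  qed
  moreover have "Z t \<le> thr n" using t by (intro Zle) simp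
  ultimately show ?thesis using order_trans by blast
qed

lemma sum_16_dvd_le: "(\<Sum>l<t. of_bool (16 dvd l)) \<le> real t / 16 + 1"
proof -
  have "(\<Sum>l<t. of_bool (16 dvd l)) = (t + 15) div 16"
  proof (induction t)
    case (Suc t)
    have "Suc (t + 15) = t + 16" by simp
    then have "Suc (t + 15) mod 16 = t mod 16" by (simp only: mod_add_self2)
    then have "Suc (t + 15) div 16 = (t + 15) div 16 + of_bool (16 dvd t)"
      by (simp only: div_Suc dvd_eq_mod_eq_0) simp
    then show ?case using Suc by simp
  qed simp
  then have "real (\<Sum>l<t. of_bool (16 dvd l)) = real ((t + 15) div 16)" by (simp only:)
  also have "\<dots> \<le> real (t + 15) / 16" using of_nat_div_le_of_nat[of "t + 15" 16, where 'a = real] by simp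
  finally show ?thesis by simp
qed

text \<open>The count is rounded up to an even number, which books the forced second entry together
  with the first. The rounded count can then grow, by 2, only at multiples of 16 or at
  deviations.\<close>

lemma zeros_root_hist_le:
  assumes modes: "\<And>t. T \<le> t \<Longrightarrow> \<forall>k<4. cur 4 (root_hist \<omega> roll t) k \<le> thr (blk t)"
    and t: "T \<le> t"
  shows "real (zeros (root_hist \<omega> roll t)) \<le> real T + 1 + 2 * (real t / 16 + 1)
     + 2 * (\<Sum>l<t. of_bool (dev_root \<omega> l))"
proof -
  define F where "F r = zeros r + of_bool (odd (zeros r))" for r
  have "real (F (root_hist \<omega> roll t)) \<le> real T + 1
      + (\<Sum>l\<in>{T..<t}. 2 * of_bool (16 dvd l) + 2 * of_bool (dev_root \<omega> l))"
    using t
  proof (induction t rule: dec_induct)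
    case base
    show ?case using zeros_le[of "root_hist \<omega> roll T"] by (simp add: F_def)
  next
    case (step t)
    let ?r = "root_hist \<omega> roll t"
    define a where "a = alg 4 (rev ?r) (\<omega> (t, [], True))"
    obtain x where h: "root_hist \<omega> roll (Suc t) = (a, x) # ?r"
      by (simp add: Let_def a_def)
    have "F ((a, x) # ?r) \<le> F ?r + 2 * of_bool (16 dvd t) + 2 * of_bool (dev_root \<omega> t)"
    proof (cases "dev_root \<omega> t")
      case False
      then have "a = pat 4 ?r"
        unfolding a_def using modes[OF step.hyps(1)]
        by (subst alg_eq_pat) (auto simp: dev_root_def deviates_def)
      then show ?thesis by (auto simp: F_def zeros_Cons pat_def)
    qed (auto simp: F_def zeros_Cons)
    then have "real (F ((a, x) # ?r)) \<le> real (F ?r + 2 * of_bool (16 dvd t) + 2 * of_bool (dev_root \<omega> t))"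
      by (rule of_nat_mono)
    then have "real (F (root_hist \<omega> roll (Suc t)))
        \<le> real (F ?r) + (2 * of_bool (16 dvd t) + 2 * of_bool (dev_root \<omega> t))"
      unfolding h by simp
    then show ?case using step by (simp del: root_hist.simps)
  qed
  also have "(\<Sum>l\<in>{T..<t}. 2 * of_bool (16 dvd l) + 2 * of_bool (dev_root \<omega> l))
      \<le> (\<Sum>l<t. 2 * of_bool (16 dvd l) + 2 * of_bool (dev_root \<omega> l) :: real)"
    by (intro sum_mono2) auto
  also have "\<dots> = 2 * (\<Sum>l<t. of_bool (16 dvd l)) + 2 * (\<Sum>l<t. of_bool (dev_root \<omega> l))"
    by (simp only: sum.distrib sum_distrib_left)
  also have "(\<Sum>l<t. of_bool (16 dvd l)) \<le> real t / 16 + 1" by (rule sum_16_dvd_le)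
  finally have "real (F (root_hist \<omega> roll t)) \<le> real T + 1
      + (2 * (real t / 16 + 1) + 2 * (\<Sum>l<t. of_bool (dev_root \<omega> l)))"
    by simp
  moreover have "real (zeros (root_hist \<omega> roll t)) \<le> real (F (root_hist \<omega> roll t))"
    by (simp add: F_def)
  ultimately show ?thesis by linarith
qed

text \<open>Evaluated at ends of blocks, where the deviations are counted: 1/8 from the pattern, at
  most 1/50 from deviations and at most 1/25 from the initial phase, together below 3/16.\<close>

lemma root_frequency_le:
  assumes few: "eventually (few_deviations \<omega>) sequentially" and roll: "valid_roll roll"
  shows "\<exists>\<^sub>\<infinity>t. 0 < t \<and> real (zeros (root_hist \<omega> roll t)) / real t \<le> 3 / 16"
proof -
  obtain N where N: "0 < N" "\<And>n. N \<le> n \<Longrightarrow> few_deviations \<omega> n"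
  proof -
    from few obtain N where "\<And>n. N \<le> n \<Longrightarrow> few_deviations \<omega> n"
      unfolding eventually_sequentially by blast
    then show ?thesis by (intro that[of "Suc N"]) auto
  qed
  obtain M where M: "600 * (1 + real (N ^ 20)) \<le> real M" using real_arch_simple by blast
  define n0 where "n0 = max N M"
  have modes: "\<forall>k<4. cur 4 (root_hist \<omega> roll t) k \<le> thr (blk t)" if "n0 ^ 20 \<le> t" for t
  proof (rule root_mode[OF N(2) N(1)])
    have "n0 \<le> blk t" by (rule blk_ge[OF that])
    then show "N \<le> blk t" "600 * (1 + real (N ^ 20)) \<le> real (Suc (blk t))"
      using M by (auto simp: n0_def)
  qed (use blk_bounds roll in auto)
  obtain L where L: "25 * (real (n0 ^ 20) + 3) \<le> real L" using real_arch_simple by blast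
  show ?thesis
    unfolding INFM_nat_le
  proof
    fix m
    define n where "n = max (max m n0) L"
    define t where "t = Suc n ^ 20"
    have tn: "Suc n \<le> t" unfolding t_def by (rule self_le_power) auto
    have n: "m \<le> n" "n0 \<le> n" "L \<le> n" "N \<le> n" by (auto simp: n_def n0_def)
    have "n0 ^ 20 \<le> t" unfolding t_def using n by (intro power_mono) auto
    from zeros_root_hist_le[OF modes this]
    have "real (zeros (root_hist \<omega> roll t)) \<le> real (n0 ^ 20) + 1 + 2 * (real t / 16 + 1)
      + 2 * (\<Sum>l<t. of_bool (dev_root \<omega> l))" .
    moreover have "100 * (\<Sum>l<t. of_bool (dev_root \<omega> l)) \<le> real t"
    proof -
      have "100 * (\<Sum>l<t. of_bool (dev_root \<omega> l)) \<le> thr n"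
        using N(2)[OF n(4)] unfolding few_deviations_def t_def by blast
      also have "thr n \<le> real (Suc n) ^ 20" unfolding thr_def by (intro power_increasing) auto
      finally show ?thesis by (simp add: t_def)
    qed
    moreover have "25 * (real (n0 ^ 20) + 3) \<le> real t"
    proof (rule order_trans[OF L])
      have "L \<le> t" using tn n by linarith
      then show "real L \<le> real t" by (rule of_nat_mono)
    qed
    moreover have t0: "0 < real t" using tn by simp
    moreover have "z \<le> 3 / 16 * x"
      if "z \<le> c + 1 + 2 * (x / 16 + 1) + 2 * s" "100 * s \<le> x" "25 * (c + 3) \<le> x" "0 < x" for z c x s :: real
      using that by argo
    ultimately have "real (zeros (root_hist \<omega> roll t)) \<le> 3 / 16 * real t" by blast
    with t0 have "real (zeros (root_hist \<omega> roll t)) / real t \<le> 3 / 16"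
      by (simp only: divide_le_eq if_True)
    moreover have "m \<le> t" "0 < t" using tn n by linarith+
    ultimately show "\<exists>t\<ge>m. 0 < t \<and> real (zeros (root_hist \<omega> roll t)) / real t \<le> 3 / 16"
      by blast
  qed
qed

section \<open>The game\<close>

definition inner_game :: game where
  "inner_game = Node 2 3 (\<lambda>i j. Terminal (pay i j))"

text \<open>The arms 1, 2 and 3 all wait for the payoff 0; the copies serve to make 4 the mark of
  the root player.\<close>

definition counter_game :: game where
  "counter_game = Node 4 1 (\<lambda>i j. if i = 0 then inner_game else Terminal 0)"

lemma wf_counter_game: "wf_game counter_game"
  by (simp add: counter_game_def inner_game_def pay_bounds)

lemma alg_1: "alg 1 h u = 0"
  by (simp add: alg_def)

text \<open>Identifies the search with the processes above. Both indices are shifted by one, since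
  the first iteration only adds the root and the first entry only adds the inner node.\<close>

lemma mcts_state_counter_game:
  "\<exists>hs. mcts_state alg roll counter_game \<omega> (Suc t) [] = Some hs \<and>
     map (\<lambda>(i, j, x). (i, x)) hs = rev (root_hist \<omega> roll t) \<and>
     (case zeros (root_hist \<omega> roll t) of
        0 \<Rightarrow> mcts_state alg roll counter_game \<omega> (Suc t) [(0, 0)] = None
      | Suc m \<Rightarrow> \<exists>hs'. mcts_state alg roll counter_game \<omega> (Suc t) [(0, 0)] = Some hs' \<and>
          map (\<lambda>(i, j, x). (i, x)) hs' = rev (fst (joint \<omega> m)) \<and>
          map (\<lambda>(i, j, x). (j, 1 - x)) hs' = rev (snd (joint \<omega> m)))"
proof (induction t)
  case 0
  show ?case by (simp add: mcts_state_def counter_game_def zeros_def)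
next
  case (Suc t)
  define H where "H = mcts_state alg roll counter_game \<omega> (Suc t)"
  define r where "r = root_hist \<omega> roll t"
  obtain hs where hs: "H [] = Some hs" "map (\<lambda>(i, j, x). (i, x)) hs = rev r"
    and inner: "case zeros r of 0 \<Rightarrow> H [(0, 0)] = None
      | Suc m \<Rightarrow> \<exists>hs'. H [(0, 0)] = Some hs' \<and>
          map (\<lambda>(i, j, x). (i, x)) hs' = rev (fst (joint \<omega> m)) \<and>
          map (\<lambda>(i, j, x). (j, 1 - x)) hs' = rev (snd (joint \<omega> m))"
    using Suc unfolding H_def r_def by blast
  have lr: "length r = t" by (simp add: r_def)
  have lhs: "length hs = t" using arg_cong[OF hs(2), of length] lr by simp
  define a where "a = alg 4 (rev r) (\<omega> (t, [], True))"
  define R where "R = mcts_iter alg roll \<omega> (if a = 0 then inner_game else Terminal 0) [(a, 0)] H"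
  have st: "mcts_state alg roll counter_game \<omega> (Suc (Suc t)) = (snd R)([] := Some (hs @ [(a, 0, fst R)]))"
  proof -
    have "mcts_state alg roll counter_game \<omega> (Suc (Suc t)) = snd (mcts_iter alg roll \<omega> counter_game [] H)"
      by (simp add: mcts_state_def H_def)
    also have "\<dots> = (snd R)([] := Some (hs @ [(a, 0, fst R)]))"
      using hs lhs by (simp add: counter_game_def Let_def R_def a_def alg_1[unfolded One_nat_def])
    finally show ?thesis .
  qed
  have rh: "root_hist \<omega> roll (Suc t) = (a, if a \<noteq> 0 then 0 else if zeros r = 0 then roll [(0, 0)]
      else inner_val \<omega> (zeros r - 1)) # r"
    by (simp add: a_def r_def Let_def)
  show ?case
  proof (cases "a = 0")
    case False
    then have "R = (0, H)" by (simp add: R_def)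
    then show ?thesis unfolding st rh zeros_Cons using hs inner False
      by (cases "zeros r") simp_all
  next
    case a0: True
    show ?thesis
    proof (cases "zeros r")
      case 0
      then have "R = (roll [(0, 0)], H([(0, 0)] := Some []))"
        using inner a0 by (simp add: R_def inner_game_def)
      then show ?thesis unfolding st rh zeros_Cons using hs a0 0 by simp
    next
      case (Suc m)
      with inner obtain hs' where hs': "H [(0, 0)] = Some hs'"
        "map (\<lambda>(i, j, x). (i, x)) hs' = rev (fst (joint \<omega> m))"
        "map (\<lambda>(i, j, x). (j, 1 - x)) hs' = rev (snd (joint \<omega> m))"
        by auto
      have l': "length hs' = m" using arg_cong[OF hs'(2), of length] by simp
      obtain i j where ij: "joint_step \<omega> m (joint \<omega> m) = (i, j)" by (cases "joint_step \<omega> m (joint \<omega> m)")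
      then have i: "i = alg 2 (rev (fst (joint \<omega> m))) (\<omega> (m, [(0, 0)], True))"
        and j: "j = alg 3 (rev (snd (joint \<omega> m))) (\<omega> (m, [(0, 0)], False))"
        by (cases "joint \<omega> m"; simp)+
      have "R = (pay i j, H([(0, 0)] := Some (hs' @ [(i, j, pay i j)])))"
        using a0 hs' l' by (simp add: R_def inner_game_def Let_def i j)
      moreover have "inner_val \<omega> m = pay i j" by (simp add: inner_val_def ij)
      ultimately show ?thesis unfolding st rh zeros_Cons using hs hs' a0 Suc ij by simp
    qed
  qed
qed

lemma emp_profile_counter_game:
  assumes "0 < t"
  shows "fst (emp_profile alg roll counter_game \<omega> (Suc t)) [] 0 = real (zeros (root_hist \<omega> roll t)) / real t"
proof -
  obtain hs where hs: "mcts_state alg roll counter_game \<omega> (Suc t) [] = Some hs"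
    "map (\<lambda>(i, j, x). (i, x)) hs = rev (root_hist \<omega> roll t)"
    using mcts_state_counter_game by blast
  have l: "length hs = t" using arg_cong[OF hs(2), of length] by simp
  have "length (filter (\<lambda>(a, b, x). a = 0) hs)
      = length (filter (\<lambda>y. fst y = 0) (map (\<lambda>(i, j, x). (i, x)) hs))"
    by (induction hs) auto
  also have "\<dots> = zeros (root_hist \<omega> roll t)"
    unfolding hs(2) by (simp add: zeros_def flip: rev_filter)
  finally have "length (filter (\<lambda>(a, b, x). a = 0) hs) = zeros (root_hist \<omega> roll t)" .
  moreover have "hs \<noteq> []" using l assms by auto
  ultimately show ?thesis using l by (simp add: emp_profile_def visits_def hs(1))
qed

lemma nodes_counter_game: "nodes counter_game = {[], [(0, 0)]}"
proof
  show "nodes counter_game \<subseteq> {[], [(0, 0)]}"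
  proof
    fix p assume "p \<in> nodes counter_game"
    then obtain m n c where s: "subgame counter_game p = Some (Node m n c)" by (auto simp: nodes_def)
    show "p \<in> {[], [(0, 0)]}"
    proof (cases p)
      case (Cons y q)
      obtain i j where y: "y = (i, j)" by (cases y)
      have "i = 0" "j = 0" "subgame inner_game q = Some (Node m n c)"
        using s Cons y by (cases q; auto simp: counter_game_def split: if_splits)+
      moreover from this(3) have "q = []"
        by (cases q; cases "tl q") (auto simp: inner_game_def split: if_splits)
      ultimately show ?thesis using Cons y by simp
    qed simp
  qed
  show "{[], [(0, 0)]} \<subseteq> nodes counter_game"
    by (auto simp: nodes_def counter_game_def inner_game_def)
qed

lemma acts_counter_game:
  "acts1 counter_game [] = 4" "acts2 counter_game [] = 1"
  "acts1 counter_game [(0, 0)] = 2" "acts2 counter_game [(0, 0)] = 3"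
  by (simp_all add: acts1_def acts2_def counter_game_def inner_game_def)

lemma util_counter_game:
  assumes "strategy2 counter_game s2"
  shows "util counter_game s1 s2 = s1 [] 0 *
    (s1 [(0, 0)] 0 * s2 [(0, 0)] 0 + s1 [(0, 0)] 1 * (1 - s2 [(0, 0)] 0))"
proof -
  have "s2 [] 0 = 1" and "s2 [(0, 0)] 0 + s2 [(0, 0)] 1 + s2 [(0, 0)] 2 = 1"
    using assms unfolding strategy2_def nodes_counter_game
    by (auto simp: acts_counter_game eval_nat_numeral)
  then have "s2 [] 0 = 1" and q: "1 - s2 [(0, 0)] 0 = s2 [(0, 0)] 1 + s2 [(0, 0)] 2" by simp_all
  then show ?thesis unfolding q
    by (simp add: util_def counter_game_def inner_game_def pay_def eval_nat_numeral algebra_simps)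
qed

text \<open>Entering surely and playing the better row earns player 1 at least 1/2, while no
  strategy earns more than its probability of entering. A gap of at most 1/4 forces that probability
  to be at least 1/4.\<close>

lemma eps_NE_counter_game:
  assumes "eps_NE counter_game (1 / 4) \<tau>"
  shows "1 / 4 \<le> fst \<tau> [] 0"
proof -
  obtain s1 s2 where \<tau>: "\<tau> = (s1, s2)" by (cases \<tau>)
  have S: "strategy1 counter_game s1" "strategy2 counter_game s2"
    and le: "(SUP s\<in>{s. strategy1 counter_game s}. util counter_game s s2) - util counter_game s1 s2 \<le> 1 / 4"
    using assms by (auto simp: eps_NE_def \<tau>)
  let ?q = "s2 [(0, 0)] 0"
  have q: "0 \<le> ?q" "?q \<le> 1"
  proof -
    have nn: "\<And>j. j < 3 \<Longrightarrow> 0 \<le> s2 [(0, 0)] j" and "(\<Sum>j<3. s2 [(0, 0)] j) = 1"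
      using S(2) unfolding strategy2_def nodes_counter_game by (auto simp: acts_counter_game)
    then have "?q + s2 [(0, 0)] 1 + s2 [(0, 0)] 2 = 1" by (simp add: eval_nat_numeral)
    then show "0 \<le> ?q" "?q \<le> 1" using nn[of 0] nn[of 1] nn[of 2] by simp_all
  qed
  have b: "0 \<le> s [] 0 \<and> s [] 0 \<le> 1 \<and> 0 \<le> s [(0, 0)] 0 * ?q + s [(0, 0)] 1 * (1 - ?q)
      \<and> s [(0, 0)] 0 * ?q + s [(0, 0)] 1 * (1 - ?q) \<le> 1" if "strategy1 counter_game s" for s
  proof -
    have s: "\<And>i. i < 4 \<Longrightarrow> 0 \<le> s [] i" "s [] 0 + s [] 1 + s [] 2 + s [] 3 = 1"
      "0 \<le> s [(0, 0)] 0" "0 \<le> s [(0, 0)] 1" "s [(0, 0)] 0 + s [(0, 0)] 1 = 1"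
      using that unfolding strategy1_def nodes_counter_game
      by (auto simp: acts_counter_game eval_nat_numeral)
    have "s [(0, 0)] 0 * ?q + s [(0, 0)] 1 * (1 - ?q) \<le> s [(0, 0)] 0 * 1 + s [(0, 0)] 1 * 1"
      using s q by (intro add_mono mult_left_mono) auto
    then show ?thesis using s(1)[of 0] s(1)[of 1] s(1)[of 2] s(1)[of 3] s(2-) q by auto
  qed
  have bdd: "bdd_above ((\<lambda>s. util counter_game s s2) ` {s. strategy1 counter_game s})"
    using b unfolding util_counter_game[OF S(2)]
    by (intro bdd_aboveI[of _ 1]) (auto intro!: mult_le_one)
  define i :: nat where "i = of_bool (?q < 1 / 2)"
  define s :: strat where "s p k = of_bool (if p = [] then k = 0 else k = i)" for p k
  have "strategy1 counter_game s"
    unfolding strategy1_def nodes_counter_game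
    by (auto simp: acts_counter_game eval_nat_numeral s_def i_def)
  then have "util counter_game s s2 \<le> (SUP s\<in>{s. strategy1 counter_game s}. util counter_game s s2)"
    using bdd by (intro cSUP_upper) auto
  moreover have "1 / 2 \<le> util counter_game s s2"
    unfolding util_counter_game[OF S(2)] by (auto simp: s_def i_def)
  moreover have "util counter_game s1 s2 \<le> s1 [] 0"
    unfolding util_counter_game[OF S(2)] using b[OF S(1)] by (intro mult_left_le) auto
  ultimately show ?thesis using le by (simp add: \<tau>)
qed

text \<open>The single coordinate for entering at the root already keeps the profile at distance 1/4
  - 3/16 = 1/16 from every approximate equilibrium.\<close>

lemma not_converges_counter_game:
  assumes "\<exists>\<^sub>\<infinity>t. fst (f t) [] 0 \<le> 3 / 16"
  shows "\<not> converges_to_set counter_game f {\<sigma>. eps_NE counter_game (1 / 4) \<sigma>}"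
proof
  assume "converges_to_set counter_game f {\<sigma>. eps_NE counter_game (1 / 4) \<sigma>}"
  then have ev: "eventually (\<lambda>t. \<exists>\<tau>\<in>{\<sigma>. eps_NE counter_game (1 / 4) \<sigma>}. prof_dist counter_game (f t) \<tau> < 1 / 16) sequentially"
    unfolding converges_to_set_def by (auto dest: spec[of _ "1 / 16"])
  have "eventually (\<lambda>t. \<not> fst (f t) [] 0 \<le> 3 / 16) sequentially"
    using ev
  proof eventually_elim
    case (elim t)
    then obtain \<tau> where \<tau>: "eps_NE counter_game (1 / 4) \<tau>" "prof_dist counter_game (f t) \<tau> < 1 / 16" by auto
    have "\<bar>fst (f t) [] 0 - fst \<tau> [] 0\<bar> \<le> (\<Sum>i<4. \<bar>fst (f t) [] i - fst \<tau> [] i\<bar>)"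
      by (intro member_le_sum[of 0 "{..<4}" "\<lambda>i. \<bar>fst (f t) [] i - fst \<tau> [] i\<bar>"]) auto
    also have "\<dots> \<le> prof_dist counter_game (f t) \<tau>"
      unfolding prof_dist_def nodes_counter_game by (simp add: acts_counter_game sum_nonneg)
    finally show ?case using \<tau> eps_NE_counter_game[OF \<tau>(1)] by linarith
  qed
  with assms show False by (simp add: frequently_def cofinite_eq_sequentially)
qed

theorem theorem4:
  shows "\<exists>G A. wf_game G \<and> valid_alg A \<and> hannan_consistent 0 A \<and> guaranteed_exploration A \<and>
     (\<forall>roll. valid_roll roll \<longrightarrow>
        (AE \<omega> in mcts_space.
           \<not> converges_to_set G (emp_profile A roll G \<omega>) {\<sigma>. eps_NE G (1/4) \<sigma>}))"
proof (intro exI conjI allI impI)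
  fix roll assume roll: "valid_roll roll"
  show "AE \<omega> in mcts_space. \<not> converges_to_set counter_game
      (emp_profile alg roll counter_game \<omega>) {\<sigma>. eps_NE counter_game (1/4) \<sigma>}"
    using AE_few_deviations
  proof eventually_elim
    case (elim \<omega>)
    have "\<exists>\<^sub>\<infinity>t. fst (emp_profile alg roll counter_game \<omega> t) [] 0 \<le> 3 / 16"
      unfolding INFM_nat_le
    proof
      fix m
      obtain t where t: "m \<le> t" "0 < t" "real (zeros (root_hist \<omega> roll t)) / real t \<le> 3 / 16"
        using root_frequency_le[OF elim roll] unfolding INFM_nat_le by blast
      then show "\<exists>t\<ge>m. fst (emp_profile alg roll counter_game \<omega> t) [] 0 \<le> 3 / 16"
        using emp_profile_counter_game[OF t(2), of roll \<omega>] by (intro exI[of _ "Suc t"]) simp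
    qed
    then show ?case by (rule not_converges_counter_game)
  qed
qed (rule wf_counter_game valid_alg_alg hannan_consistent_alg guaranteed_exploration_alg)+

end
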